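(* There are Martin-Löf tests $\mathcal W=(\mathcal W_i)_{i\in\omega}$ and $\mathcal V=(\mathcal V_i)_{i\in\omega}$ such that (i) $\mathcal W$ is universal, (ii) for every $i$ there is $j$ with $\mathcal V_j\subseteq\mathcal W_i$, and (iii) every function $f\colon\omega\to\omega$ satisfying $\mathcal V_{f(i)}\subseteq\mathcal W_i$ for all $i$ satisfies $f\ge_T 0''$.
   Context: Work in Cantor space $2^\omega$ with Lebesgue measure $\lambda$. For $\sigma\in 2^{<\omega}$, $[\sigma]=\{X\in 2^\omega:\sigma\prec X\}$. A sequence $(\mathcal U_i)_{i\in\omega}$ of open subsets of $2^\omega$ is uniformly effectively open if $\{\langle i,\sigma\rangle : [\sigma]\subseteq\mathcal U_i\}$ is computably enumerable. A Martin-Löf (ML) test is a uniformly effectively open sequence $(\mathcal V_i)_{i\in\omega}$ with $\lambda(\mathcal V_i)\le 2^{-i}$ for all $i$. An ML-test $\mathcal U$ is universal if $\bigcap_i\mathcal V_i\subseteq\bigcap_i\mathcal U_i$ for every ML-test $\mathcal V$. $0''$ denotes the second Turing jump of the empty set and $\ge_T$ Turing reducibility. *)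

theory Defs
  imports "HOL-Probability.Probability" "HOL-Library.Nat_Bijection"
begin

datatype recf = Zero | Succ | Proj nat | Comp recf "recf list" | Prim recf recf | Mn recf | Oracle

inductive eval :: "(nat \<Rightarrow> nat) \<Rightarrow> recf \<Rightarrow> nat list \<Rightarrow> nat \<Rightarrow> bool" for g where
  ev_zero: "eval g Zero xs 0"
| ev_succ: "eval g Succ (x # xs) (Suc x)"
| ev_proj: "i < length xs \<Longrightarrow> eval g (Proj i) xs (xs ! i)"
| ev_comp: "list_all2 (\<lambda>h z. eval g h xs z) hs zs \<Longrightarrow> eval g f zs y \<Longrightarrow> eval g (Comp f hs) xs y"
| ev_prim0: "eval g f xs y \<Longrightarrow> eval g (Prim f h) (0 # xs) y"
| ev_primS: "eval g (Prim f h) (n # xs) z \<Longrightarrow> eval g h (n # z # xs) y \<Longrightarrow> eval g (Prim f h) (Suc n # xs) y"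
| ev_mn: "eval g f (n # xs) 0 \<Longrightarrow> (\<forall>m<n. \<exists>y. 0 < y \<and> eval g f (m # xs) y) \<Longrightarrow> eval g (Mn f) xs n"
| ev_oracle: "eval g Oracle (x # xs) (g x)"

fun code :: "recf \<Rightarrow> nat" where
  "code Zero = prod_encode (0, 0)"
| "code Succ = prod_encode (1, 0)"
| "code (Proj i) = prod_encode (2, i)"
| "code (Comp f hs) = prod_encode (3, prod_encode (code f, list_encode (map code hs)))"
| "code (Prim f h) = prod_encode (4, prod_encode (code f, code h))"
| "code (Mn f) = prod_encode (5, code f)"
| "code Oracle = prod_encode (6, 0)"

definition chr :: "nat set \<Rightarrow> nat \<Rightarrow> nat" where
  "chr A n = (if n \<in> A then 1 else 0)"

definition turing_le :: "(nat \<Rightarrow> nat) \<Rightarrow> (nat \<Rightarrow> nat) \<Rightarrow> bool" where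
  "turing_le h g \<longleftrightarrow> (\<exists>t. \<forall>x. eval g t [x] (h x))"

definition jump :: "(nat \<Rightarrow> nat) \<Rightarrow> nat set" where
  "jump g = {code t | t. \<exists>y. eval g t [code t] y}"

definition zero_jump2 :: "nat set" where
  "zero_jump2 = jump (chr (jump (chr {})))"

definition ce :: "nat set \<Rightarrow> bool" where
  "ce S \<longleftrightarrow> (\<exists>t. S = {x. \<exists>y. eval (chr {}) t [x] y})"

type_synonym cantor = "nat \<Rightarrow> bool"

definition cyl :: "bool list \<Rightarrow> cantor set" where
  "cyl \<sigma> = {X. \<forall>i<length \<sigma>. X i = \<sigma> ! i}"

definition str_code :: "bool list \<Rightarrow> nat" where
  "str_code \<sigma> = list_encode (map (\<lambda>b. if b then 1 else 0) \<sigma>)"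

definition cantor_open :: "cantor set \<Rightarrow> bool" where
  "cantor_open U \<longleftrightarrow> (\<forall>X\<in>U. \<exists>\<sigma>. X \<in> cyl \<sigma> \<and> cyl \<sigma> \<subseteq> U)"

definition lambda_measure :: "cantor measure" where
  "lambda_measure = PiM UNIV (\<lambda>_. measure_pmf (bernoulli_pmf (1/2)))"

definition unif_eff_open :: "(nat \<Rightarrow> cantor set) \<Rightarrow> bool" where
  "unif_eff_open U \<longleftrightarrow> (\<forall>i. cantor_open (U i)) \<and>
     ce {prod_encode (i, str_code \<sigma>) | i \<sigma>. cyl \<sigma> \<subseteq> U i}"

definition mltest :: "(nat \<Rightarrow> cantor set) \<Rightarrow> bool" where
  "mltest V \<longleftrightarrow> unif_eff_open V \<and> (\<forall>i. measure lambda_measure (V i) \<le> (1/2) ^ i)"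

definition universal_mltest :: "(nat \<Rightarrow> cantor set) \<Rightarrow> bool" where
  "universal_mltest U \<longleftrightarrow> mltest U \<and> (\<forall>V. mltest V \<longrightarrow> (\<Inter>i. V i) \<subseteq> (\<Inter>i. U i))"

end

theory Submission
  imports Defs
begin

text \<open>
  Let \<open>A\<^sub>m\<^sub>,\<^sub>i\<close> be the \<open>i\<close>-th component of the \<open>m\<close>-th c.e. set of strings, trimmed to measure
  \<open>2\<^sup>-\<^sup>i\<close>, and let \<open>hits e\<close> be the union over \<open>m\<close> of the \<open>A\<close> with \<open>i = e + m + 4\<close>; all these unions
  together have measure at most \<open>1/4\<close>. At stage \<open>n\<close> one can therefore choose computably a string
  \<open>hole n\<close> of length \<open>n + 3\<close>, disjoint from the earlier holes and from everything enumerated into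
  any \<open>hits e\<close> so far. From then on, a point \<open>X\<close> of \<open>hole n\<close> enters \<open>W e\<close> only through the smaller set
  \<open>hits (e + n + 3)\<close>, which cannot cover the hole. This does not harm universality: a point that
  lies in a hole lies in only one of them, and if it is not random it is in \<open>hits\<close> of every index.

  So for any c.e. relation \<open>Q\<close> one may additionally put \<open>hole n\<close> into \<open>W e\<close> exactly when \<open>Q e n\<close>.
  With \<open>V j\<close> the union of the holes \<open>\<langle>j, k\<rangle>\<close>, the inclusion of \<open>V j\<close> in \<open>W e\<close> expresses
  \<open>\<forall>k. Q e \<langle>j, k\<rangle>\<close>, an arbitrary \<open>\<Pi>\<^sub>2\<close> condition. Letting it say that \<open>j\<close> encodes \<open>e\<close> together with
  a correct answer (and a witness, if the answer is positive) to \<open>e \<in> 0''\<close>, one reads off \<open>0''\<close>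
  from every \<open>f\<close> as in the theorem.
\<close>

section \<open>Closure properties of computable functions\<close>

inductive_cases eval_ZeroE: "eval g Zero xs y"
inductive_cases eval_SuccE: "eval g Succ xs y"
inductive_cases eval_ProjE: "eval g (Proj i) xs y"
inductive_cases eval_CompE: "eval g (Comp f hs) xs y"
inductive_cases eval_PrimE: "eval g (Prim f h) xs y"
inductive_cases eval_MnE: "eval g (Mn f) xs y"
inductive_cases eval_OracleE: "eval g Oracle xs y"

text \<open>Needed to read runs backwards: a value found by a halting run must be the one already
  known, as in \<open>ce_Collect_semidec\<close>.\<close>

lemma eval_deterministic: "eval g t xs y \<Longrightarrow> eval g t xs z \<Longrightarrow> z = y"
proof (induction arbitrary: z rule: eval.induct)
  case (ev_comp xs hs zs f y)
  from \<open>eval g (Comp f hs) xs z\<close> obtain zs' where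
    *: "list_all2 (\<lambda>h z. eval g h xs z) hs zs'" "eval g f zs' z"
    by (rule eval_CompE) blast
  have "zs' = zs"
    using *(1) ev_comp.IH(1) by (auto simp: list_all2_conv_all_nth intro!: nth_equalityI)
  with * ev_comp.IH(2) show ?case by blast
next
  case (ev_mn f n xs)
  from \<open>eval g (Mn f) xs z\<close> have
    *: "eval g f (z # xs) 0" "\<forall>m<z. \<exists>y. 0 < y \<and> eval g f (m # xs) y"
    by (rule eval_MnE; blast)+
  \<comment> \<open>Were the two results different, the program \<open>f\<close> would return both 0
    and a positive value at the smaller one.\<close>
  have "\<not> z < n" "\<not> n < z"
    using ev_mn.IH * ev_mn.hyps by (metis less_irrefl)+
  then show ?case by simp
qed (blast elim: eval_ZeroE eval_SuccE eval_ProjE eval_PrimE eval_OracleE)+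

lemma eval_Proj0: "eval g (Proj 0) (x # xs) x"
  and eval_Proj1: "eval g (Proj (Suc 0)) (x # y # xs) y"
  and eval_Proj2: "eval g (Proj 2) (x # y # z # xs) z"
  using ev_proj[of 0 "x # xs" g] ev_proj[of 1 "x # y # xs" g] ev_proj[of 2 "x # y # z # xs" g]
  by simp_all

lemma eval_Comp1: "eval g h xs z \<Longrightarrow> eval g f [z] y \<Longrightarrow> eval g (Comp f [h]) xs y"
  by (rule ev_comp[of _ _ _ "[z]"]) auto

lemma eval_Comp2:
  "eval g h xs z \<Longrightarrow> eval g h' xs z' \<Longrightarrow> eval g f [z, z'] y \<Longrightarrow> eval g (Comp f [h, h']) xs y"
  by (rule ev_comp[of _ _ _ "[z, z']"]) auto

section \<open>Programs for arithmetic and for the pairing function\<close>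

definition rec_add :: recf where
  "rec_add = Prim (Proj 0) (Comp Succ [Proj (Suc 0)])"

definition rec_pred :: recf where
  "rec_pred = Prim Zero (Proj 0)"

text \<open>\<open>Prim\<close> recurses on the first argument, so the subtrahend comes first:
  \<open>[m, n]\<close> yields \<open>n - m\<close>.\<close>

definition rec_sub :: recf where
  "rec_sub = Prim (Proj 0) (Comp rec_pred [Proj (Suc 0)])"

definition rec_triangle :: recf where
  "rec_triangle = Prim Zero (Comp rec_add [Comp Succ [Proj 0], Proj (Suc 0)])"

definition rec_pair :: recf where
  "rec_pair = Comp rec_add [Comp rec_triangle [rec_add], Proj 0]"

text \<open>\<open>prod_encode (a, b) = triangle (a + b) + a\<close>, so \<open>a + b\<close> is the least \<open>s\<close> with
  \<open>n < triangle (Suc s)\<close>.\<close>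

definition rec_diag :: recf where
  "rec_diag = Mn (Comp rec_sub [Comp rec_triangle [Comp Succ [Proj 0]], Comp Succ [Proj (Suc 0)]])"

definition rec_fst :: recf where
  "rec_fst = Comp rec_sub [Comp rec_triangle [rec_diag], Proj 0]"

definition rec_snd :: recf where
  "rec_snd = Comp rec_sub [rec_fst, rec_diag]"

fun rec_const :: "nat \<Rightarrow> recf" where
  "rec_const 0 = Zero"
| "rec_const (Suc n) = Comp Succ [rec_const n]"

lemma eval_add: "eval g rec_add [m, n] (m + n)"
  unfolding rec_add_def
  by (induction m) (auto intro: eval.intros eval_Proj0 eval_Proj1 eval_Comp1)

lemma eval_pred: "eval g rec_pred [n] (n - 1)"
  unfolding rec_pred_def
  by (induction n) (auto intro: eval.intros eval_Proj0)

lemma eval_sub: "eval g rec_sub [m, n] (n - m)"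
  unfolding rec_sub_def
proof (induction m)
  case (Suc m)
  have "eval g rec_pred [n - m] (n - Suc m)"
    using eval_pred[of g "n - m"] by simp
  then show ?case
    by (auto intro: ev_primS[OF Suc] eval_Proj1 eval_Comp1)
qed (auto intro: eval.intros eval_Proj0)

lemma eval_triangle: "eval g rec_triangle [n] (triangle n)"
  unfolding rec_triangle_def
proof (induction n)
  case (Suc n)
  have "eval g (Comp rec_add [Comp Succ [Proj 0], Proj (Suc 0)]) [n, triangle n] (Suc n + triangle n)"
    by (rule eval_Comp2 eval_Comp1 eval_add eval_Proj0 eval_Proj1 ev_succ)+
  then show ?case
    using ev_primS[OF Suc] by (simp add: add.commute)
qed (auto intro: eval.intros)

lemma eval_pair: "eval g rec_pair [m, n] (prod_encode (m, n))"
  unfolding rec_pair_def prod_encode_def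
  by (auto intro!: eval_Comp2 eval_Comp1 eval_add eval_triangle eval_Proj0)

lemma triangle_mono: "m \<le> n \<Longrightarrow> triangle m \<le> triangle n"
  by (induction n) (auto simp: le_Suc_eq)

lemma eval_diag: "eval g rec_diag [prod_encode (a, b)] (a + b)"
  unfolding rec_diag_def
proof (rule ev_mn)
  let ?n = "prod_encode (a, b)"
  let ?t = "Comp rec_sub [Comp rec_triangle [Comp Succ [Proj 0]], Comp Succ [Proj (Suc 0)]]"
  have *: "eval g ?t [s, ?n] (Suc ?n - triangle (Suc s))" for s
    by (rule eval_Comp2 eval_Comp1 eval_sub eval_triangle eval_Proj0 eval_Proj1 ev_succ)+
  have "Suc ?n - triangle (Suc (a + b)) = 0"
    by (simp add: prod_encode_def)
  then show "eval g ?t [a + b, ?n] 0"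
    using *[of "a + b"] by simp
  show "\<forall>m<a + b. \<exists>y. 0 < y \<and> eval g ?t [m, ?n] y"
  proof (intro allI impI)
    fix m assume "m < a + b"
    then have "triangle (Suc m) \<le> triangle (a + b)"
      by (intro triangle_mono) simp
    then have "0 < Suc ?n - triangle (Suc m)"
      by (simp add: prod_encode_def)
    with * show "\<exists>y. 0 < y \<and> eval g ?t [m, ?n] y" by blast
  qed
qed

lemma eval_fst: "eval g rec_fst [prod_encode (a, b)] a"
proof -
  have "eval g rec_fst [prod_encode (a, b)] (prod_encode (a, b) - triangle (a + b))"
    unfolding rec_fst_def
    by (rule eval_Comp2 eval_Comp1 eval_sub eval_triangle eval_diag eval_Proj0)+
  then show ?thesis by (simp add: prod_encode_def)
qed

lemma eval_snd: "eval g rec_snd [prod_encode (a, b)] b"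
proof -
  have "eval g rec_snd [prod_encode (a, b)] (a + b - a)"
    unfolding rec_snd_def by (rule eval_Comp2 eval_sub eval_diag eval_fst)+
  then show ?thesis by simp
qed

lemma eval_const: "eval g (rec_const n) xs n"
  by (induction n) (auto intro: eval.intros eval_Comp1)

text \<open>Only injectivity is required; \<open>bool\<close> has just the codes 0 and 1. Where a
  search has to run through a whole type, surjectivity is assumed in addition. The instances follow
  \<open>prod_encode\<close> and \<open>list_encode\<close>, so that they agree with the codes used
  in the definitions of the notions.\<close>

class enc =
  fixes enc :: "'a \<Rightarrow> nat"
  assumes enc_inj: "enc x = enc y \<Longrightarrow> x = y"

lemma enc_eq_iff: "enc x = enc y \<longleftrightarrow> x = y"
  using enc_inj by blast

instantiation nat :: enc
begin
definition enc_nat :: "nat \<Rightarrow> nat" where [simp]: "enc_nat n = n"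
instance by standard simp
end

instantiation bool :: enc
begin
definition enc_bool :: "bool \<Rightarrow> nat" where "enc_bool b = (if b then 1 else 0)"
instance by standard (simp add: enc_bool_def split: if_splits)
end

instantiation prod :: (enc, enc) enc
begin
definition enc_prod :: "'a \<times> 'b \<Rightarrow> nat" where
  "enc_prod p = prod_encode (enc (fst p), enc (snd p))"
instance by standard (auto simp: enc_prod_def prod_encode_eq enc_eq_iff prod_eq_iff)
end

instantiation list :: (enc) enc
begin
definition enc_list :: "'a list \<Rightarrow> nat" where
  "enc_list l = list_encode (map enc l)"
instance
proof
  fix x y :: "'a list"
  assume "enc x = enc y"
  then have "map enc x = map enc y" by (simp add: enc_list_def list_encode_eq)
  then show "x = y" by (rule map_injective) (auto intro: injI enc_inj)
qed
end

lemma enc_Nil [simp]: "enc [] = 0"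
  and enc_Cons: "enc (x # xs) = Suc (prod_encode (enc x, enc xs))"
  by (simp_all add: enc_list_def)

text \<open>One program has to work under every oracle. The same closure rules then serve both for
  c.e. sets, with oracle \<open>chr {}\<close>, and for the final reduction, with oracle
  \<open>f\<close>.\<close>

definition computable :: "('a::enc \<Rightarrow> 'b::enc) \<Rightarrow> bool" where
  "computable f \<longleftrightarrow> (\<exists>t. \<forall>g x. eval g t [enc x] (enc (f x)))"

named_theorems comp_intros

section \<open>Composition, arithmetic, truth values and bounded quantifiers\<close>

lemma computable_id [comp_intros]: "computable (\<lambda>x. x)"
  unfolding computable_def by (blast intro: eval_Proj0)

lemma computable_const [comp_intros]: "computable (\<lambda>x. c)"
  unfolding computable_def by (blast intro: eval_const)

lemma computable_comp: "computable f \<Longrightarrow> computable g \<Longrightarrow> computable (\<lambda>x. f (g x))"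
  unfolding computable_def by (meson eval_Comp1)

lemma computable_Pair [comp_intros]:
  assumes "computable f" "computable g"
  shows "computable (\<lambda>x. (f x, g x))"
proof -
  obtain t u where "\<And>g' x. eval g' t [enc x] (enc (f x))" "\<And>g' x. eval g' u [enc x] (enc (g x))"
    using assms unfolding computable_def by blast
  then have "\<And>g' x. eval g' (Comp rec_pair [t, u]) [enc x] (enc (f x, g x))"
    unfolding enc_prod_def by (auto intro!: eval_Comp2 eval_pair)
  then show ?thesis unfolding computable_def by blast
qed

lemma computable_fst [comp_intros]: "computable f \<Longrightarrow> computable (\<lambda>x. fst (f x))"
  by (rule computable_comp[where f=fst])
    (auto simp: computable_def enc_prod_def intro: eval_fst)

lemma computable_snd [comp_intros]: "computable f \<Longrightarrow> computable (\<lambda>x. snd (f x))"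
  by (rule computable_comp[where f=snd])
    (auto simp: computable_def enc_prod_def intro: eval_snd)

lemma computable_comp2:
  assumes "computable (\<lambda>p. F (fst p) (snd p))" "computable f" "computable g"
  shows "computable (\<lambda>x. F (f x) (g x))"
  using computable_comp[OF assms(1) computable_Pair[OF assms(2,3)]] by simp

lemma computable_comp3:
  assumes "computable (\<lambda>p. F (fst p) (fst (snd p)) (snd (snd p)))"
    "computable f" "computable g" "computable h"
  shows "computable (\<lambda>x. F (f x) (g x) (h x))"
  using computable_comp[OF assms(1) computable_Pair[OF assms(2) computable_Pair[OF assms(3,4)]]]
  by simp

lemma computable_Suc [comp_intros]: "computable f \<Longrightarrow> computable (\<lambda>x. Suc (f x))"
  by (rule computable_comp[where f=Suc]) (auto simp: computable_def intro: ev_succ)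

lemma computable_prod_encode [comp_intros]:
  "computable f \<Longrightarrow> computable g \<Longrightarrow> computable (\<lambda>x. prod_encode (f x, g x))"
  by (rule computable_comp2[where F="\<lambda>a b. prod_encode (a, b)"])
    (auto simp: computable_def enc_prod_def intro: eval_Proj0)

lemma computable_enc [comp_intros]:
  assumes "computable f"
  shows "computable (\<lambda>x. enc (f x))"
  using assms unfolding computable_def by simp

lemma computable_rec_nat [comp_intros]:
  assumes "computable a" "computable n"
    and "computable (\<lambda>p. b (fst p) (fst (snd p)) (snd (snd p)))"
  shows "computable (\<lambda>x. rec_nat (a x) (b x) (n x))"
proof -
  obtain ta tb tn where
    a: "\<And>g x. eval g ta [enc x] (enc (a x))"
    and n: "\<And>g x. eval g tn [enc x] (n x)"
    and b: "\<And>g p. eval g tb [enc p] (enc (b (fst p) (fst (snd p)) (snd (snd p))))"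
    using assms unfolding computable_def enc_nat_def by metis
  \<comment> \<open>\<open>Prim\<close> hands its step the arguments \<open>k\<close>,
    \<open>z\<close>, \<open>x\<close> separately and in this order, whereas \<open>tb\<close>
    expects the code of \<open>(x, k, z)\<close>.\<close>
  let ?s = "Comp tb [Comp rec_pair [Proj 2, Comp rec_pair [Proj 0, Proj (Suc 0)]]]"
  have s: "eval g ?s [k, enc z, enc x] (enc (b x k z))" for g k z x
    using b[of g "(x, k, z)"]
    by (auto simp: enc_prod_def intro!: eval_Comp1 eval_Comp2 eval_pair eval_Proj0 eval_Proj1 eval_Proj2)
  have "eval g (Prim ta ?s) [k, enc x] (enc (rec_nat (a x) (b x) k))" for g k x
    by (induction k) (auto intro: ev_prim0 a ev_primS s)
  then have "eval g (Comp (Prim ta ?s) [tn, Proj 0]) [enc x] (enc (rec_nat (a x) (b x) (n x)))" for g x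
    by (rule eval_Comp2[OF n eval_Proj0])
  then show ?thesis unfolding computable_def by blast
qed

lemma computable_add [comp_intros]:
  assumes "computable f" "computable g"
  shows "computable (\<lambda>x. f x + g x :: nat)"
proof -
  have "rec_nat m (\<lambda>_ z. Suc z) n = m + n" for m n by (induction n) auto
  moreover have "computable (\<lambda>x. rec_nat (f x) (\<lambda>_ z. Suc z) (g x))"
    by (intro comp_intros assms)
  ultimately show ?thesis by simp
qed

lemma computable_pred [comp_intros]: "computable f \<Longrightarrow> computable (\<lambda>x. f x - Suc 0)"
  by (rule computable_comp[where f="\<lambda>n. n - Suc 0"])
    (auto simp: computable_def intro: eval_pred[simplified])

lemma computable_diff [comp_intros]:
  assumes "computable f" "computable g"
  shows "computable (\<lambda>x. f x - g x :: nat)"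
proof -
  have "rec_nat m (\<lambda>_ z. z - Suc 0) n = m - n" for m n by (induction n) auto
  moreover have "computable (\<lambda>x. rec_nat (f x) (\<lambda>_ z. z - Suc 0) (g x))"
    by (intro comp_intros assms)
  ultimately show ?thesis by simp
qed

lemma computable_mult [comp_intros]:
  assumes "computable f" "computable g"
  shows "computable (\<lambda>x. f x * g x :: nat)"
proof -
  have "rec_nat 0 (\<lambda>_ z. z + m) n = n * m" for m n :: nat by (induction n) auto
  moreover have "computable (\<lambda>x. rec_nat 0 (\<lambda>_ z. z + f x) (g x))"
    by (intro comp_intros assms computable_comp[OF assms(1)])
  ultimately show ?thesis by (simp add: mult.commute)
qed

lemma computable_power2 [comp_intros]:
  assumes "computable f"
  shows "computable (\<lambda>x. 2 ^ f x :: nat)"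
proof -
  have "rec_nat (1::nat) (\<lambda>_ z. z + z) n = (2::nat) ^ n" for n by (induction n) auto
  moreover have "computable (\<lambda>x. rec_nat (1::nat) (\<lambda>_ z. z + z) (f x))"
    by (intro comp_intros assms)
  ultimately show ?thesis by simp
qed

lemma computable_If [comp_intros]:
  assumes "computable c" "computable f" "computable g"
  shows "computable (\<lambda>x. if c x then f x else g x)"
proof -
  \<comment> \<open>The code of the truth value is used as the number of iterations, 0 or 1.\<close>
  have "rec_nat (g x) (\<lambda>_ _. f x) (enc (c x)) = (if c x then f x else g x)" for x
    by (simp add: enc_bool_def)
  moreover have "computable (\<lambda>x. rec_nat (g x) (\<lambda>_ _. f x) (enc (c x)))"
    by (intro comp_intros assms computable_comp[OF assms(2)])
  ultimately show ?thesis by simp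
qed

lemma computable_not [comp_intros]:
  assumes "computable P"
  shows "computable (\<lambda>x. \<not> P x)"
proof -
  have "computable (\<lambda>x. if P x then False else True)" by (intro comp_intros assms)
  moreover have "(if P x then False else True) = (\<not> P x)" for x by simp
  ultimately show ?thesis by (simp only:)
qed

lemma computable_conj [comp_intros]:
  assumes "computable P" "computable Q"
  shows "computable (\<lambda>x. P x \<and> Q x)"
proof -
  have "computable (\<lambda>x. if P x then Q x else False)" by (intro comp_intros assms)
  moreover have "(if P x then Q x else False) = (P x \<and> Q x)" for x by simp
  ultimately show ?thesis by (simp only:)
qed

lemma computable_disj [comp_intros]:
  assumes "computable P" "computable Q"
  shows "computable (\<lambda>x. P x \<or> Q x)"
proof -
  have "computable (\<lambda>x. \<not> (\<not> P x \<and> \<not> Q x))" by (intro comp_intros assms)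
  then show ?thesis by simp
qed

lemma computable_imp [comp_intros]:
  assumes "computable P" "computable Q"
  shows "computable (\<lambda>x. P x \<longrightarrow> Q x)"
proof -
  have "computable (\<lambda>x. \<not> P x \<or> Q x)" by (intro comp_intros assms)
  then show ?thesis by simp
qed

lemma computable_le [comp_intros]:
  assumes "computable f" "computable g"
  shows "computable (\<lambda>x. f x \<le> (g x :: nat))"
proof -
  have "rec_nat True (\<lambda>_ _. False) (f x - g x) = (f x \<le> g x)" for x
    by (cases "f x - g x") auto
  moreover have "computable (\<lambda>x. rec_nat True (\<lambda>_ _. False) (f x - g x))"
    by (intro comp_intros assms)
  ultimately show ?thesis by simp
qed

lemma computable_less [comp_intros]:
  "computable f \<Longrightarrow> computable g \<Longrightarrow> computable (\<lambda>x. f x < (g x :: nat))"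
  unfolding Suc_le_eq[symmetric] by (intro comp_intros)

lemma computable_eq [comp_intros]:
  fixes f :: "'a::enc \<Rightarrow> 'b::enc"
  assumes "computable f" "computable g"
  shows "computable (\<lambda>x. f x = g x)"
proof -
  have "(f x = g x) = (enc (f x) \<le> enc (g x) \<and> enc (g x) \<le> enc (f x))" for x
    using enc_inj[of "f x" "g x"] by auto
  moreover have "computable (\<lambda>x. enc (f x) \<le> enc (g x) \<and> enc (g x) \<le> enc (f x))"
    by (intro comp_intros assms)
  ultimately show ?thesis by simp
qed

lemma computable_Ex_less [comp_intros]:
  fixes n :: "'a::enc \<Rightarrow> nat"
  assumes "computable n" "computable (\<lambda>p. P (fst p) (snd p))"
  shows "computable (\<lambda>x. \<exists>k<n x. P x k)"
proof -
  have "rec_nat False (\<lambda>k z. z \<or> P x k) m = (\<exists>k<m. P x k)" for x m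
    by (induction m) (auto simp: less_Suc_eq)
  moreover have "computable (\<lambda>x. rec_nat False (\<lambda>k z. z \<or> P x k) (n x))"
    by (intro comp_intros assms computable_comp2[where F=P])
  ultimately show ?thesis by simp
qed

lemma computable_All_less [comp_intros]:
  fixes n :: "'a::enc \<Rightarrow> nat"
  assumes "computable n" "computable (\<lambda>p. P (fst p) (snd p))"
  shows "computable (\<lambda>x. \<forall>k<n x. P x k)"
proof -
  have "computable (\<lambda>x. \<not> (\<exists>k<n x. \<not> P x k))"
    by (intro comp_intros assms)
  then show ?thesis by simp
qed

lemma computable_Ex_le [comp_intros]:
  fixes n :: "'a::enc \<Rightarrow> nat"
  assumes "computable n" "computable (\<lambda>p. P (fst p) (snd p))"
  shows "computable (\<lambda>x. \<exists>k\<le>n x. P x k)"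
  unfolding less_Suc_eq_le[symmetric] by (intro comp_intros assms)

lemma computable_All_le [comp_intros]:
  fixes n :: "'a::enc \<Rightarrow> nat"
  assumes "computable n" "computable (\<lambda>p. P (fst p) (snd p))"
  shows "computable (\<lambda>x. \<forall>k\<le>n x. P x k)"
  unfolding less_Suc_eq_le[symmetric] by (intro comp_intros assms)

section \<open>Operations on lists\<close>

lemma computable_Cons [comp_intros]:
  assumes "computable f" "computable g"
  shows "computable (\<lambda>x. f x # g x)"
proof -
  have "computable (\<lambda>x. Suc (prod_encode (enc (f x), enc (g x))))"
    by (intro comp_intros assms)
  then show ?thesis by (simp add: computable_def enc_Cons)
qed

lemma eval_dec_tl: "eval g (Comp rec_snd [rec_pred]) [enc l] (enc (tl l))"
proof -
  have "eval g rec_snd [enc l - 1] (enc (tl l))"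
  proof (cases l)
    case Nil
    \<comment> \<open>The empty list has code 0; the predecessor of 0 is 0 again, which decodes to
      \<open>(0, 0)\<close>, and so the result is the code of \<open>tl [] = []\<close>.\<close>
    have "prod_encode (0, 0) = 0" by (simp add: prod_encode_def)
    with eval_snd[of g 0 0] Nil show ?thesis by simp
  qed (simp add: enc_Cons eval_snd)
  then show ?thesis by (rule eval_Comp1[OF eval_pred])
qed

lemma computable_tl [comp_intros]: "computable f \<Longrightarrow> computable (\<lambda>x. tl (f x))"
  by (rule computable_comp[where f=tl]) (auto simp: computable_def intro: eval_dec_tl)

lemma computable_hd [comp_intros]: "computable f \<Longrightarrow> computable (\<lambda>x. hd (f x :: 'b::enc list))"
proof (rule computable_comp[where f=hd])
  \<comment> \<open>The unspecified but fixed value \<open>hd []\<close> is built in as a constant.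
    The recursion only distinguishes code 0 from a successor and ignores the previous value.\<close>
  let ?t = "Prim (rec_const (enc (hd [] :: 'b))) (Comp rec_fst [Proj 0])"
  have "eval g ?t [enc l] (enc (hd l :: 'b))" for g l
  proof (cases l)
    case Nil
    then show ?thesis by (auto intro: ev_prim0 eval_const)
  next
    case (Cons x xs)
    have "eval g ?t [n] (rec_nat (enc (hd [] :: 'b)) (\<lambda>k _. fst (prod_decode k)) n)" for n
    proof (induction n)
      case (Suc n)
      have "eval g rec_fst [n] (fst (prod_decode n))"
        using eval_fst[of g "fst (prod_decode n)" "snd (prod_decode n)"] by simp
      then show ?case by (auto intro: ev_primS[OF Suc] eval_Comp1 eval_Proj0)
    qed (auto intro: ev_prim0 eval_const)
    from this[of "enc l"] show ?thesis by (simp add: Cons enc_Cons)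
  qed
  then show "computable (hd :: 'b list \<Rightarrow> 'b)" unfolding computable_def by blast
qed

text \<open>The code of a list bounds its length, so iterating the step \<open>enc l\<close> times consumes \<open>l\<close>.\<close>

lemma computable_foldl [comp_intros]:
  fixes F :: "'a::enc \<Rightarrow> 'c::enc \<Rightarrow> 'b::enc \<Rightarrow> 'c"
  assumes "computable (\<lambda>p. F (fst p) (fst (snd p)) (snd (snd p)))" "computable z" "computable l"
  shows "computable (\<lambda>x. foldl (F x) (z x) (l x))"
proof -
  let ?step = "\<lambda>x p. if snd p = [] then p else (F x (fst p) (hd (snd p)), tl (snd p))"
  define it where "it x n = rec_nat (z x, l x) (\<lambda>_. ?step x) n" for x n
  have it: "foldl (F x) (fst (it x n)) (snd (it x n)) = foldl (F x) (z x) (l x)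
      \<and> length (snd (it x n)) = length (l x) - n" for x n
  proof (induction n)
    case (Suc n)
    have "it x (Suc n) = ?step x (it x n)" by (simp add: it_def)
    with Suc show ?case by (cases "snd (it x n)") auto
  qed (simp add: it_def)
  have len: "length m \<le> enc m" for m :: "'b list"
  proof (induction m)
    case (Cons a m)
    have "enc m \<le> prod_encode (enc a, enc m)" by (rule le_prod_encode_2)
    with Cons show ?case by (simp add: enc_Cons)
  qed simp
  have "foldl (F x) (z x) (l x) = fst (it x (enc (l x)))" for x
    using it[of x "enc (l x)"] len[of "l x"] by auto
  moreover have "computable (\<lambda>x. fst (it x (enc (l x))))"
    unfolding it_def by (intro comp_intros assms computable_comp3[where F=F])
  ultimately show ?thesis by simp
qed

lemma computable_rev [comp_intros]:
  assumes "computable l"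
  shows "computable (\<lambda>x. rev (l x))"
proof -
  have "foldl (\<lambda>a y. y # a) b m = rev m @ b" for m b :: "'b list"
    by (induction m arbitrary: b) auto
  moreover have "computable (\<lambda>x. foldl (\<lambda>a y. y # a) [] (l x))"
    by (intro comp_intros assms)
  ultimately show ?thesis by simp
qed

lemma computable_append [comp_intros]:
  assumes "computable l" "computable m"
  shows "computable (\<lambda>x. l x @ m x)"
proof -
  have "foldl (\<lambda>a y. y # a) b c = rev c @ b" for b c :: "'b list"
    by (induction c arbitrary: b) auto
  moreover have "computable (\<lambda>x. foldl (\<lambda>a y. y # a) (m x) (rev (l x)))"
    by (intro comp_intros assms)
  ultimately show ?thesis by simp
qed

lemma computable_map [comp_intros]:
  fixes f :: "'a::enc \<Rightarrow> 'b::enc \<Rightarrow> 'c::enc"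
  assumes "computable (\<lambda>p. f (fst p) (snd p))" "computable l"
  shows "computable (\<lambda>x. map (f x) (l x))"
proof -
  have "foldl (\<lambda>a y. a @ [f x y]) b m = b @ map (f x) m" for x m b
    by (induction m arbitrary: b) auto
  moreover have "computable (\<lambda>x. foldl (\<lambda>a y. a @ [f x y]) [] (l x))"
    by (intro comp_intros assms computable_comp2[where F=f])
  ultimately show ?thesis by simp
qed

lemma computable_filter [comp_intros]:
  fixes P :: "'a::enc \<Rightarrow> 'b::enc \<Rightarrow> bool"
  assumes "computable (\<lambda>p. P (fst p) (snd p))" "computable l"
  shows "computable (\<lambda>x. filter (P x) (l x))"
proof -
  have "foldl (\<lambda>a y. if P x y then a @ [y] else a) b m = b @ filter (P x) m" for x m b
    by (induction m arbitrary: b) auto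
  moreover have "computable (\<lambda>x. foldl (\<lambda>a y. if P x y then a @ [y] else a) [] (l x))"
    by (intro comp_intros assms computable_comp2[where F=P])
  ultimately show ?thesis by simp
qed

lemma computable_length [comp_intros]:
  assumes "computable l"
  shows "computable (\<lambda>x. length (l x))"
proof -
  have "foldl (\<lambda>a y. Suc a) b m = length m + b" for b and m :: "'b list"
    by (induction m arbitrary: b) auto
  moreover have "computable (\<lambda>x. foldl (\<lambda>a y. Suc a) 0 (l x))"
    by (intro comp_intros assms)
  ultimately show ?thesis by simp
qed

lemma computable_Bex_set [comp_intros]:
  assumes "computable (\<lambda>p. P (fst p) (snd p))" "computable l"
  shows "computable (\<lambda>x. \<exists>y\<in>set (l x). P x y)"
proof -
  have "(filter (P x) (l x) \<noteq> []) = (\<exists>y\<in>set (l x). P x y)" for x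
    by (auto simp: filter_empty_conv)
  moreover have "computable (\<lambda>x. filter (P x) (l x) \<noteq> [])"
    by (intro comp_intros assms)
  ultimately show ?thesis by simp
qed

lemma computable_Ball_set [comp_intros]:
  assumes "computable (\<lambda>p. P (fst p) (snd p))" "computable l"
  shows "computable (\<lambda>x. \<forall>y\<in>set (l x). P x y)"
proof -
  have "computable (\<lambda>x. \<not> (\<exists>y\<in>set (l x). \<not> P x y))"
    by (intro comp_intros assms)
  then show ?thesis by simp
qed

lemma computable_mem [comp_intros]:
  assumes "computable f" "computable l"
  shows "computable (\<lambda>x. f x \<in> set (l x))"
proof -
  have "computable (\<lambda>x. \<exists>y\<in>set (l x). f x = y)"
    by (intro comp_intros assms computable_comp[OF assms(1)])
  then show ?thesis by simp
qed

lemma computable_drop [comp_intros]: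
  assumes "computable n" "computable l"
  shows "computable (\<lambda>x. drop (n x) (l x))"
proof -
  have "rec_nat m (\<lambda>_. tl) k = drop k m" for k and m :: "'b list"
    by (induction k) (auto simp: drop_Suc drop_tl)
  moreover have "computable (\<lambda>x. rec_nat (l x) (\<lambda>_. tl) (n x))"
    by (intro comp_intros assms)
  ultimately show ?thesis by simp
qed

lemma computable_take [comp_intros]:
  assumes "computable n" "computable l"
  shows "computable (\<lambda>x. take (n x) (l x))"
proof -
  have "rev (drop (length m - k) (rev m)) = take k m" for k and m :: "'b list"
    by (cases "k \<le> length m") (auto simp: rev_drop)
  moreover have "computable (\<lambda>x. rev (drop (length (l x) - n x) (rev (l x))))"
    by (intro comp_intros assms)
  ultimately show ?thesis by (simp only:)
qed

section \<open>Semidecidable predicates\<close>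

text \<open>Projections of computable relations are easier to combine than domains of programs: the
  closure properties only rearrange witnesses. The passage to programs is made once, in
  \<open>ce_Collect_semidec\<close>.\<close>

definition semidec :: "('a::enc \<Rightarrow> bool) \<Rightarrow> bool" where
  "semidec P \<longleftrightarrow> (\<exists>R::'a \<times> nat \<Rightarrow> bool. computable R \<and> (\<forall>x. P x \<longleftrightarrow> (\<exists>n. R (x, n))))"

named_theorems semidec_intros

lemma semidecI: "computable (\<lambda>p. R (fst p) (snd p)) \<Longrightarrow> (\<And>x. P x \<longleftrightarrow> (\<exists>n::nat. R x n)) \<Longrightarrow> semidec P"
  unfolding semidec_def by (intro exI[of _ "\<lambda>p. R (fst p) (snd p)"]) auto

lemma semidecE:
  assumes "semidec P"
  obtains R where "computable (\<lambda>p. R (fst p) (snd p))" "\<And>x. P x \<longleftrightarrow> (\<exists>n::nat. R x n)"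
proof -
  obtain R where R: "computable R" "\<forall>x. P x \<longleftrightarrow> (\<exists>n::nat. R (x, n))"
    using assms unfolding semidec_def by blast
  from that[of "\<lambda>x n. R (x, n)"] R show ?thesis by simp
qed

lemma semidec_computable: "computable P \<Longrightarrow> semidec P"
  using computable_comp[OF _ computable_fst[OF computable_id], of P]
  by (intro semidecI[of "\<lambda>x n. P x"]) auto

lemma semidec_comp:
  assumes "semidec P" "computable f"
  shows "semidec (\<lambda>x. P (f x))"
proof -
  from assms(1) obtain R where R: "computable (\<lambda>p. R (fst p) (snd p))" "\<And>x. P x \<longleftrightarrow> (\<exists>n::nat. R x n)"
    by (rule semidecE) blast
  have "computable (\<lambda>p. R (f (fst p)) (snd p))"
    by (intro computable_comp2[OF R(1)] computable_comp[OF assms(2)] comp_intros)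
  then show ?thesis by (rule semidecI) (simp add: R(2))
qed

lemma semidec_comp2:
  assumes "semidec (\<lambda>p. P (fst p) (snd p))" "computable f" "computable g"
  shows "semidec (\<lambda>x. P (f x) (g x))"
  using semidec_comp[OF assms(1) computable_Pair[OF assms(2,3)]] by simp

lemma semidec_Ex [semidec_intros]:
  fixes P :: "'a::enc \<Rightarrow> nat \<Rightarrow> bool"
  assumes "semidec (\<lambda>p. P (fst p) (snd p))"
  shows "semidec (\<lambda>x. \<exists>n. P x n)"
proof -
  from assms obtain R where R: "computable (\<lambda>p. R (fst p) (snd p))"
    "\<And>p. P (fst p) (snd p) \<longleftrightarrow> (\<exists>n::nat. R p n)"
    by (rule semidecE) blast
  \<comment> \<open>A single bound \<open>b\<close> lies above both the number quantified over and
    its witness, so one quantifier replaces two.\<close>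
  let ?S = "\<lambda>x b. \<exists>k<b. \<exists>n<b. R (x, k) n"
  have "computable (\<lambda>p. ?S (fst p) (snd p))"
    by (intro comp_intros computable_comp2[OF R(1)])
  moreover have "(\<exists>k. P x k) \<longleftrightarrow> (\<exists>b. ?S x b)" for x
  proof
    assume "\<exists>k. P x k"
    then obtain k n where "R (x, k) n" using R(2)[of "(x, _)"] by auto
    then have "\<exists>i<Suc (max k n). R (x, k) i" by (intro exI[of _ n]) auto
    then have "?S x (Suc (max k n))" by (intro exI[of _ k]) auto
    then show "\<exists>b. ?S x b" ..
  next
    assume "\<exists>b. ?S x b"
    then show "\<exists>k. P x k" using R(2)[of "(x, _)"] by auto
  qed
  ultimately show ?thesis by (rule semidecI)
qed

lemma semidec_Ex_enum:
  fixes f :: "nat \<Rightarrow> 'b::enc" and P :: "'a::enc \<Rightarrow> 'b \<Rightarrow> bool"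
  assumes "computable f" "surj f" "semidec (\<lambda>p. P (fst p) (snd p))"
  shows "semidec (\<lambda>x. \<exists>y. P x y)"
proof -
  have "(\<exists>y. P x y) \<longleftrightarrow> (\<exists>n. P x (f n))" for x
    using assms(2) by (metis surj_def)
  moreover have "semidec (\<lambda>x. \<exists>n. P x (f n))"
    by (intro semidec_intros semidec_comp2[OF assms(3)] comp_intros computable_comp[OF assms(1)])
  ultimately show ?thesis by simp
qed

lemma semidec_conj [semidec_intros]:
  assumes "semidec P" "semidec Q"
  shows "semidec (\<lambda>x. P x \<and> Q x)"
proof -
  obtain R S where R: "computable (\<lambda>p. R (fst p) (snd p))" "\<And>x. P x \<longleftrightarrow> (\<exists>n::nat. R x n)"
    and S: "computable (\<lambda>p. S (fst p) (snd p))" "\<And>x. Q x \<longleftrightarrow> (\<exists>n::nat. S x n)"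
    using assms by (elim semidecE) blast
  have "semidec (\<lambda>x. \<exists>m. \<exists>n. R x m \<and> S x n)"
    by (intro semidec_intros semidec_computable comp_intros computable_comp2[OF R(1)]
        computable_comp2[OF S(1)])
  then show ?thesis by (simp add: R(2) S(2))
qed

lemma semidec_disj [semidec_intros]:
  assumes "semidec P" "semidec Q"
  shows "semidec (\<lambda>x. P x \<or> Q x)"
proof -
  obtain R S where R: "computable (\<lambda>p. R (fst p) (snd p))" "\<And>x. P x \<longleftrightarrow> (\<exists>n::nat. R x n)"
    and S: "computable (\<lambda>p. S (fst p) (snd p))" "\<And>x. Q x \<longleftrightarrow> (\<exists>n::nat. S x n)"
    using assms by (elim semidecE) blast
  have "semidec (\<lambda>x. \<exists>m. R x m \<or> S x m)"
    by (intro semidec_intros semidec_computable comp_intros computable_comp2[OF R(1)]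
        computable_comp2[OF S(1)])
  then show ?thesis by (simp add: R(2) S(2) ex_disj_distrib)
qed

lemma semidec_Bex_set [semidec_intros]:
  assumes "semidec (\<lambda>p. P (fst p) (snd p))" "computable l"
  shows "semidec (\<lambda>x. \<exists>y\<in>set (l x). P x y)"
proof -
  from assms obtain R where R: "computable (\<lambda>p. R (fst p) (snd p))"
    "\<And>p. P (fst p) (snd p) \<longleftrightarrow> (\<exists>n::nat. R p n)"
    by (auto elim: semidecE)
  have "semidec (\<lambda>x. \<exists>n. \<exists>y\<in>set (l x). R (x, y) n)"
    by (intro semidec_intros semidec_computable comp_intros computable_comp2[OF R(1)]
        computable_comp[OF assms(2)])
  moreover have "(\<exists>y\<in>set (l x). P x y) \<longleftrightarrow> (\<exists>n. \<exists>y\<in>set (l x). R (x, y) n)" for x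
    using R(2)[of "(x, _)"] by auto
  ultimately show ?thesis by simp
qed

text \<open>Finitely many witnesses have a common bound, and this bound is the new single
  witness.\<close>

lemma semidec_Ball_set [semidec_intros]:
  assumes "semidec (\<lambda>p. P (fst p) (snd p))" "computable l"
  shows "semidec (\<lambda>x. \<forall>y\<in>set (l x). P x y)"
proof -
  from assms obtain R where R: "computable (\<lambda>p. R (fst p) (snd p))"
    "\<And>p. P (fst p) (snd p) \<longleftrightarrow> (\<exists>n::nat. R p n)"
    by (auto elim: semidecE)
  have "semidec (\<lambda>x. \<exists>b. \<forall>y\<in>set (l x). \<exists>n<b. R (x, y) n)"
    by (intro semidec_intros semidec_computable comp_intros computable_comp2[OF R(1)]
        computable_comp[OF assms(2)])
  moreover have "(\<forall>y\<in>set (l x). P x y) \<longleftrightarrow> (\<exists>b. \<forall>y\<in>set (l x). \<exists>n<b. R (x, y) n)" for x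
  proof
    assume "\<forall>y\<in>set (l x). P x y"
    then have "\<forall>y\<in>set (l x). \<exists>n. R (x, y) n" using R(2)[of "(x, _)"] by auto
    then obtain f where f: "\<And>y. y \<in> set (l x) \<Longrightarrow> R (x, y) (f y)" by metis
    have "f y < Suc (Max (f ` set (l x)))" if "y \<in> set (l x)" for y
      using that by (simp add: less_Suc_eq_le)
    with f show "\<exists>b. \<forall>y\<in>set (l x). \<exists>n<b. R (x, y) n" by blast
  next
    assume "\<exists>b. \<forall>y\<in>set (l x). \<exists>n<b. R (x, y) n"
    then show "\<forall>y\<in>set (l x). P x y" using R(2)[of "(x, _)"] by auto
  qed
  ultimately show ?thesis by simp
qed

lemma ce_Collect_semidec:
  assumes "semidec P"
  shows "ce {x. P x}"
proof -
  from assms obtain R where R: "computable (\<lambda>p. R (fst p) (snd p))" "\<And>x. P x \<longleftrightarrow> (\<exists>n::nat. R x n)"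
    by (rule semidecE) blast
  \<comment> \<open>\<open>Mn\<close> searches for the value 0 and \<open>enc\<close> maps
    \<open>False\<close> to 0, hence the program for the negation of \<open>R\<close>.\<close>
  from computable_not[OF R(1)] obtain t where
    t: "\<And>g p. eval g t [enc p] (enc (\<not> R (fst p) (snd p)))"
    unfolding computable_def by blast
  let ?u = "Comp t [Comp rec_pair [Proj (Suc 0), Proj 0]]"
  have u: "eval g ?u [n, x] (if R x n then 0 else 1)" for g n x
  proof -
    have "eval g (Comp rec_pair [Proj (Suc 0), Proj 0]) [n, x] (enc (x, n))"
      unfolding enc_prod_def by (auto intro: eval_Comp2 eval_pair eval_Proj0 eval_Proj1)
    from eval_Comp1[OF this t] show ?thesis by (simp add: enc_bool_def if_distrib if_bool_eq_conj)
  qed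
  have "P x \<longleftrightarrow> (\<exists>y. eval (chr {}) (Mn ?u) [x] y)" for x
  proof
    assume "P x"
    then have ex: "\<exists>n. R x n" by (simp add: R(2))
    \<comment> \<open>\<open>ev_mn\<close> demands positive values below its result, so the least
      witness is taken.\<close>
    define n where "n = (LEAST n. R x n)"
    have "R x n" unfolding n_def using ex by (rule LeastI_ex)
    moreover have "\<not> R x m" if "m < n" for m using that unfolding n_def by (rule not_less_Least)
    ultimately have "eval (chr {}) ?u [n, x] 0" "\<And>m. m < n \<Longrightarrow> eval (chr {}) ?u [m, x] 1"
      using u[of "chr {}" _ x] by (metis, metis)
    then have "eval (chr {}) (Mn ?u) [x] n" by (blast intro: ev_mn zero_less_one)
    then show "\<exists>y. eval (chr {}) (Mn ?u) [x] y" ..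
  next
    assume "\<exists>y. eval (chr {}) (Mn ?u) [x] y"
    then obtain y where "eval (chr {}) ?u [y, x] 0" by (blast elim: eval_MnE)
    from eval_deterministic[OF this u] have "(if R x y then 0 else 1) = (0::nat)" .
    then show "P x" by (auto simp: R(2) split: if_splits)
  qed
  then have "{x. P x} = {x. \<exists>y. eval (chr {}) (Mn ?u) [x] y}" by simp
  then show ?thesis unfolding ce_def by (rule exI)
qed

section \<open>Arithmetization of evaluation\<close>

text \<open>A derivation in Hilbert style: each entry follows by \<open>J\<close> from the entries
  before it. Writing \<open>hd (drop i d)\<close> for \<open>d ! i\<close> keeps to operations with
  computability rules.\<close>

definition chain :: "('a list \<Rightarrow> 'a \<Rightarrow> bool) \<Rightarrow> 'a list \<Rightarrow> bool" where
  "chain J d \<longleftrightarrow> (\<forall>i<length d. J (take i d) (hd (drop i d)))"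

lemma chain_Nil [simp]: "chain J []"
  by (simp add: chain_def)

text \<open>Premises stand at earlier positions, so this is induction on the position. It yields
  soundness of every system of rules below.\<close>

lemma chain_induct:
  assumes "chain J d" "x \<in> set d"
    and step: "\<And>D x. x \<in> set d \<Longrightarrow> J D x \<Longrightarrow> (\<And>y. y \<in> set D \<Longrightarrow> P y) \<Longrightarrow> P x"
  shows "P x"
proof -
  have "P (d ! i)" if "i < length d" for i
    using that
  proof (induction i rule: less_induct)
    case (less i)
    have "J (take i d) (d ! i)"
      using assms(1) less.prems by (simp add: chain_def hd_drop_conv_nth)
    then show ?case
    proof (rule step[rotated])
      show "d ! i \<in> set d" using less.prems by simp
      fix y assume "y \<in> set (take i d)"
      then obtain k where "k < i" "k < length d" "y = d ! k"
        by (auto simp: in_set_conv_nth)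
      with less show "P y" by simp
    qed
  qed
  with assms(2) show ?thesis by (metis in_set_conv_nth)
qed

text \<open>Weakening. It permits concatenating chains: the entries of the second one then merely
  see more premises.\<close>

definition mono_rule :: "('a list \<Rightarrow> 'a \<Rightarrow> bool) \<Rightarrow> bool" where
  "mono_rule J \<longleftrightarrow> (\<forall>D D' x. set D \<subseteq> set D' \<longrightarrow> J D x \<longrightarrow> J D' x)"

lemma chain_append:
  assumes "mono_rule J" "chain J d" "chain J d'"
  shows "chain J (d @ d')"
  unfolding chain_def
proof (intro allI impI)
  fix i assume i: "i < length (d @ d')"
  show "J (take i (d @ d')) (hd (drop i (d @ d')))"
  proof (cases "i < length d")
    case True
    then show ?thesis using assms(2) by (simp add: chain_def)
  next
    case False
    then have "J (take (i - length d) d') (hd (drop (i - length d) d'))"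
      using i assms(3) by (simp add: chain_def)
    moreover have "set (take (i - length d) d') \<subseteq> set (take i (d @ d'))"
      using False by auto
    ultimately have "J (take i (d @ d')) (hd (drop (i - length d) d'))"
      using assms(1) unfolding mono_rule_def by blast
    with False show ?thesis by simp
  qed
qed

lemma chain_snoc:
  assumes "chain J d" "J d x"
  shows "chain J (d @ [x])"
  using assms by (auto simp: chain_def less_Suc_eq)

text \<open>The side condition \<open>P\<close> is kept apart from the rule. For evaluation it is
  agreement with the oracle, which need not be decidable, while the rule is.\<close>

definition reach :: "('a list \<Rightarrow> 'a \<Rightarrow> bool) \<Rightarrow> ('a \<Rightarrow> bool) \<Rightarrow> 'a \<Rightarrow> bool" where
  "reach J P x \<longleftrightarrow> (\<exists>d. chain J d \<and> (\<forall>y\<in>set d. P y) \<and> x \<in> set d)"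

lemma reach_finite:
  assumes "mono_rule J" "finite X" "\<And>x. x \<in> X \<Longrightarrow> reach J P x"
  shows "\<exists>d. chain J d \<and> (\<forall>y\<in>set d. P y) \<and> X \<subseteq> set d"
  using assms(2,3)
proof (induction X)
  case (insert x X)
  obtain d where "chain J d" "\<forall>y\<in>set d. P y" "X \<subseteq> set d"
    using insert by auto
  moreover obtain d' where "chain J d'" "\<forall>y\<in>set d'. P y" "x \<in> set d'"
    using insert.prems[of x] by (auto simp: reach_def)
  ultimately show ?case
    using chain_append[OF assms(1), of d d'] by (intro exI[of _ "d @ d'"]) auto
qed (auto intro: exI[of _ "[]"])

text \<open>Concatenate chains for the finitely many premises and append the conclusion.\<close>

lemma reach_step:
  assumes "mono_rule J" "finite X" "\<And>x. x \<in> X \<Longrightarrow> reach J P x"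
    and "\<And>D. X \<subseteq> set D \<Longrightarrow> J D x" "P x"
  shows "reach J P x"
proof -
  obtain d where "chain J d" "\<forall>y\<in>set d. P y" "X \<subseteq> set d"
    using reach_finite[OF assms(1-3)] by auto
  with assms(4,5) show ?thesis
    unfolding reach_def by (intro exI[of _ "d @ [x]"]) (auto intro: chain_snoc)
qed

lemma computable_chain:
  assumes "computable (\<lambda>p. J (fst p) (snd p))"
  shows "computable (chain J)"
proof -
  have "computable (\<lambda>d. \<forall>i<length d. J (take i d) (hd (drop i d)))"
    by (intro comp_intros computable_comp2[OF assms])
  then show ?thesis by (simp add: chain_def[abs_def])
qed

section \<open>Decoding, and search through encoded types\<close>

lemma computable_prod_decode [comp_intros]:
  "computable f \<Longrightarrow> computable (\<lambda>x. prod_decode (f x))"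
  by (rule computable_comp[where f=prod_decode])
    (auto simp: computable_def enc_prod_def intro: eval_Proj0)

lemma computable_list_decode [comp_intros]:
  "computable f \<Longrightarrow> computable (\<lambda>x. list_decode (f x))"
proof (rule computable_comp[where f=list_decode])
  have "enc (list_decode n) = n" for n
    by (simp add: enc_list_def enc_nat_def[abs_def])
  then show "computable list_decode" unfolding computable_def by (auto intro: eval_Proj0)
qed

text \<open>If every number is a code, decoding does nothing on the level of codes, so a projection
  computes it.\<close>

lemma computable_inv_enc: "surj (enc :: 'a::enc \<Rightarrow> nat) \<Longrightarrow> computable (inv enc :: nat \<Rightarrow> 'a)"
  unfolding computable_def by (auto simp: surj_f_inv_f intro: eval_Proj0)

lemma surj_enc_nat: "surj (enc :: nat \<Rightarrow> nat)"
  by (simp add: enc_nat_def[abs_def])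

lemma surj_enc_prod:
  assumes "surj (enc :: 'a::enc \<Rightarrow> nat)" "surj (enc :: 'b::enc \<Rightarrow> nat)"
  shows "surj (enc :: 'a \<times> 'b \<Rightarrow> nat)"
proof (rule surjI)
  show "enc (inv enc (fst (prod_decode n)) :: 'a, inv enc (snd (prod_decode n)) :: 'b) = n" for n
    using assms by (simp add: enc_prod_def surj_f_inv_f)
qed

lemma surj_enc_list:
  assumes "surj (enc :: 'a::enc \<Rightarrow> nat)"
  shows "surj (enc :: 'a list \<Rightarrow> nat)"
proof (rule surjI)
  show "enc (map (inv enc :: nat \<Rightarrow> 'a) (list_decode n)) = n" for n
    using assms by (simp add: enc_list_def surj_f_inv_f o_def)
qed

lemma semidec_Ex_surj:
  fixes P :: "'a::enc \<Rightarrow> 'b::enc \<Rightarrow> bool"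
  assumes surj: "surj (enc :: 'b \<Rightarrow> nat)" and "semidec (\<lambda>p. P (fst p) (snd p))"
  shows "semidec (\<lambda>x. \<exists>y. P x y)"
proof (rule semidec_Ex_enum[OF computable_inv_enc[OF surj] _ assms(2)])
  show "surj (inv enc :: nat \<Rightarrow> 'b)"
    by (rule inj_imp_surj_inv) (auto intro: injI enc_inj)
qed

definition code_arg1 :: "nat \<Rightarrow> nat" where
  "code_arg1 c = fst (prod_decode (snd (prod_decode c)))"

definition code_arg2 :: "nat \<Rightarrow> nat" where
  "code_arg2 c = snd (prod_decode (snd (prod_decode c)))"

lemma computable_code_arg [comp_intros]:
  assumes "computable f"
  shows "computable (\<lambda>x. code_arg1 (f x))" "computable (\<lambda>x. code_arg2 (f x))"
  unfolding code_arg1_def code_arg2_def by (intro comp_intros assms)+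

text \<open>\<open>code\<close> is not surjective and a jump contains only codes of terms, so being
  a code has to be recognized. It is recognized by derivations whose rules are the formation rules
  of \<open>recf\<close>, one clause per constructor.\<close>

definition code_rule :: "nat list \<Rightarrow> nat \<Rightarrow> bool" where
  "code_rule S c \<longleftrightarrow>
    c = prod_encode (0, 0) \<or> c = prod_encode (1, 0) \<or> c = prod_encode (6, 0) \<or>
    fst (prod_decode c) = 2 \<or>
    fst (prod_decode c) = 3 \<and> code_arg1 c \<in> set S \<and>
      (\<forall>h\<in>set (list_decode (code_arg2 c)). h \<in> set S) \<or>
    fst (prod_decode c) = 4 \<and> code_arg1 c \<in> set S \<and> code_arg2 c \<in> set S \<or>
    fst (prod_decode c) = 5 \<and> snd (prod_decode c) \<in> set S"

lemma mono_code_rule: "mono_rule code_rule"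
  unfolding mono_rule_def code_rule_def by blast

lemma computable_code_rule: "computable (\<lambda>p. code_rule (fst p) (snd p))"
  unfolding code_rule_def by (intro comp_intros)

lemma code_rule_sound:
  assumes "code_rule S c" "\<And>h. h \<in> set S \<Longrightarrow> h \<in> range code"
  shows "c \<in> range code"
proof -
  obtain k r where c: "c = prod_encode (k, r)" by (metis prod_decode_inverse surj_pair)
  have r: "r = prod_encode (code_arg1 c, code_arg2 c)"
    by (simp add: c code_arg1_def code_arg2_def)
  consider "k = 0" "r = 0" | "k = 1" "r = 0" | "k = 6" "r = 0" | "k = 2"
    | "k = 3" "code_arg1 c \<in> set S" "set (list_decode (code_arg2 c)) \<subseteq> set S"
    | "k = 4" "code_arg1 c \<in> set S" "code_arg2 c \<in> set S"
    | "k = 5" "r \<in> set S"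
    using assms(1) unfolding code_rule_def by (auto simp: c prod_encode_eq)
  then show ?thesis
  proof cases
    case 1
    then show ?thesis using c by (auto intro: range_eqI[of _ _ Zero])
  next
    case 2
    then show ?thesis using c by (auto intro: range_eqI[of _ _ Succ])
  next
    case 3
    then show ?thesis using c by (auto intro: range_eqI[of _ _ Oracle])
  next
    case 4
    then show ?thesis using c by (auto intro: range_eqI[of _ _ "Proj r"])
  next
    case 5
    obtain f where f: "code f = code_arg1 c" using 5 assms(2) by fastforce
    define hs where "hs = map (inv code) (list_decode (code_arg2 c))"
    have "map code hs = list_decode (code_arg2 c)"
      unfolding hs_def using 5(3) assms(2) by (auto simp: f_inv_into_f intro!: map_idI)
    then have "c = code (Comp f hs)"
      using f r 5(1) by (subst c) simp
    then show ?thesis by blast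
  next
    case 6
    obtain f h where "code f = code_arg1 c" "code h = code_arg2 c"
      using 6 assms(2) by (metis imageE)
    then have "c = code (Prim f h)" using r 6(1) by (subst c) simp
    then show ?thesis by blast
  next
    case 7
    then obtain f where "code f = r" using assms(2) by fastforce
    then have "c = code (Mn f)" using c 7(1) by simp
    then show ?thesis by blast
  qed
qed

lemma reach_code: "reach code_rule (\<lambda>_. True) (code t)"
proof (induction t)
  case (Comp f hs)
  show ?case
  proof (rule reach_step[OF mono_code_rule])
    show "reach code_rule (\<lambda>_. True) x" if "x \<in> insert (code f) (code ` set hs)" for x
      using that Comp by auto
  qed (auto simp: code_rule_def code_arg1_def code_arg2_def)
next
  case (Prim f h)
  show ?case
  proof (rule reach_step[OF mono_code_rule])
    show "reach code_rule (\<lambda>_. True) x" if "x \<in> {code f, code h}" for x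
      using that Prim by auto
  qed (auto simp: code_rule_def code_arg1_def code_arg2_def)
next
  case (Mn f)
  show ?case
  proof (rule reach_step[OF mono_code_rule])
    show "reach code_rule (\<lambda>_. True) x" if "x \<in> {code f}" for x
      using that Mn by auto
  qed (auto simp: code_rule_def)
qed (rule reach_step[OF mono_code_rule, of "{}"]; auto simp: code_rule_def)+

lemma semidec_range_code: "semidec (\<lambda>c. c \<in> range code)"
proof -
  have "c \<in> range code \<longleftrightarrow> (\<exists>w. chain code_rule w \<and> c \<in> set w)" for c
  proof
    assume "c \<in> range code"
    then show "\<exists>w. chain code_rule w \<and> c \<in> set w" using reach_code by (auto simp: reach_def)
  next
    assume "\<exists>w. chain code_rule w \<and> c \<in> set w"
    then obtain w where "chain code_rule w" "c \<in> set w" by blast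
    then show "c \<in> range code" by (rule chain_induct) (rule code_rule_sound)
  qed
  moreover have "semidec (\<lambda>c. \<exists>w. chain code_rule w \<and> c \<in> set w)"
    by (intro semidec_Ex_surj surj_enc_list surj_enc_nat semidec_computable comp_intros
        computable_comp[OF computable_chain[OF computable_code_rule]])
  ultimately show ?thesis by simp
qed

section \<open>Evaluation as derivability of judgements\<close>

type_synonym judgement = "nat \<times> nat list \<times> nat"

text \<open>A judgement \<open>(c, xs, y)\<close> says that the term with code \<open>c\<close> maps \<open>xs\<close> to \<open>y\<close>. Oracle
  judgements are accepted with every answer; comparing them with the actual oracle is left to
  \<open>agrees\<close>.\<close>

definition eval_rule :: "judgement list \<Rightarrow> judgement \<Rightarrow> bool" where
  "eval_rule D j \<longleftrightarrow>
    fst j = prod_encode (0, 0) \<and> snd (snd j) = 0 \<or>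
    fst j = prod_encode (1, 0) \<and> fst (snd j) \<noteq> [] \<and> snd (snd j) = Suc (hd (fst (snd j))) \<or>
    (\<exists>i<length (fst (snd j)). fst j = prod_encode (2, i) \<and> snd (snd j) = hd (drop i (fst (snd j)))) \<or>
    fst (prod_decode (fst j)) = 3 \<and>
      (\<exists>q\<in>set D. fst q = code_arg1 (fst j) \<and> snd (snd q) = snd (snd j) \<and>
        length (fst (snd q)) = length (list_decode (code_arg2 (fst j))) \<and>
        (\<forall>k<length (fst (snd q)).
          (hd (drop k (list_decode (code_arg2 (fst j)))), fst (snd j), hd (drop k (fst (snd q)))) \<in> set D)) \<or>
    fst (prod_decode (fst j)) = 4 \<and> fst (snd j) \<noteq> [] \<and>
      (hd (fst (snd j)) = 0 \<and> (code_arg1 (fst j), tl (fst (snd j)), snd (snd j)) \<in> set D \<or>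
       0 < hd (fst (snd j)) \<and>
       (\<exists>q\<in>set D. fst q = fst j \<and> fst (snd q) = (hd (fst (snd j)) - Suc 0) # tl (fst (snd j)) \<and>
         (code_arg2 (fst j), (hd (fst (snd j)) - Suc 0) # snd (snd q) # tl (fst (snd j)), snd (snd j)) \<in> set D)) \<or>
    fst (prod_decode (fst j)) = 5 \<and>
      (snd (prod_decode (fst j)), snd (snd j) # fst (snd j), 0) \<in> set D \<and>
      (\<forall>m<snd (snd j). \<exists>q\<in>set D. fst q = snd (prod_decode (fst j)) \<and>
        fst (snd q) = m # fst (snd j) \<and> 0 < snd (snd q)) \<or>
    fst j = prod_encode (6, 0) \<and> fst (snd j) \<noteq> []"

definition agrees :: "(nat \<Rightarrow> nat) \<Rightarrow> judgement \<Rightarrow> bool" where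
  "agrees g j \<longleftrightarrow> (fst j = code Oracle \<longrightarrow> snd (snd j) = g (hd (fst (snd j))))"

lemma mono_eval_rule: "mono_rule eval_rule"
  unfolding mono_rule_def
proof (intro allI impI)
  fix D D' :: "judgement list" and j
  assume sub: "set D \<subseteq> set D'" and J: "eval_rule D j"
  then have *: "x \<in> set D \<Longrightarrow> x \<in> set D'" for x by blast
  show "eval_rule D' j"
    using J unfolding eval_rule_def by (elim disj_forward) (blast intro: *)+
qed

text \<open>Every quantifier in \<open>eval_rule\<close> ranges over the entries of a list or below
  a number, so the closure rules apply directly.\<close>

lemma computable_eval_rule: "computable (\<lambda>p. eval_rule (fst p) (snd p))"
  unfolding eval_rule_def by (intro comp_intros)

text \<open>Each disjunct of the rule inverts to an introduction rule of \<open>eval\<close>; the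
  oracle case takes its answer from the hypothesis \<open>g\<close>.\<close>

lemma eval_rule_sound:
  assumes J: "eval_rule D (code t, xs, y)"
    and D: "\<And>t xs y. (code t, xs, y) \<in> set D \<Longrightarrow> eval g t xs y"
    and g: "t = Oracle \<Longrightarrow> y = g (hd xs)"
  shows "eval g t xs y"
proof (cases t)
  case Zero
  then show ?thesis using J by (auto simp: eval_rule_def prod_encode_eq intro: eval.intros)
next
  case Succ
  then show ?thesis using J
    by (cases xs) (auto simp: eval_rule_def prod_encode_eq intro: eval.intros)
next
  case (Proj i)
  then show ?thesis using J
    by (auto simp: eval_rule_def prod_encode_eq hd_drop_conv_nth intro: eval.intros)
next
  case (Comp f hs)
  then obtain zs where zs: "(code f, zs, y) \<in> set D" "length zs = length hs"
    and k: "\<And>k. k < length zs \<Longrightarrow> (hd (drop k (map code hs)), xs, hd (drop k zs)) \<in> set D"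
    using J by (auto simp: eval_rule_def prod_encode_eq code_arg1_def code_arg2_def)
  have "list_all2 (\<lambda>h z. eval g h xs z) hs zs"
    using zs(2) k by (auto simp: list_all2_conv_all_nth hd_drop_conv_nth intro!: D)
  then show ?thesis using D[OF zs(1)] Comp by (auto intro: ev_comp)
next
  case (Prim f h)
  show ?thesis
  proof (cases xs)
    case Nil
    then show ?thesis using J Prim by (auto simp: eval_rule_def prod_encode_eq)
  next
    case (Cons n ys)
    show ?thesis
    proof (cases n)
      case 0
      then show ?thesis using J Prim Cons D
        by (auto simp: eval_rule_def prod_encode_eq code_arg1_def intro: ev_prim0)
    next
      case (Suc k)
      then have "\<exists>z. (code t, k # ys, z) \<in> set D \<and> (code h, k # z # ys, y) \<in> set D"
        using J Prim Cons by (auto simp: eval_rule_def prod_encode_eq code_arg2_def)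
      then obtain z where "eval g t (k # ys) z" "eval g h (k # z # ys) y" using D by blast
      then show ?thesis using Prim Cons Suc by (auto intro: ev_primS)
    qed
  qed
next
  case (Mn f)
  then have 0: "(code f, y # xs, 0) \<in> set D"
    and "\<forall>m<y. \<exists>q\<in>set D. fst q = code f \<and> fst (snd q) = m # xs \<and> 0 < snd (snd q)"
    using J by (auto simp: eval_rule_def prod_encode_eq)
  then have "\<forall>m<y. \<exists>v>0. (code f, m # xs, v) \<in> set D" by (metis prod.collapse)
  with 0 show ?thesis using D Mn by (blast intro: ev_mn)
next
  case Oracle
  then show ?thesis using J g
    by (cases xs) (auto simp: eval_rule_def prod_encode_eq intro: eval.intros)
qed

lemma reach_eval: "eval g t xs y \<Longrightarrow> reach eval_rule (agrees g) (code t, xs, y)"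
proof (induction rule: eval.induct)
  case (ev_comp xs hs zs f y)
  let ?X = "insert (code f, zs, y) ((\<lambda>k. (code (hs ! k), xs, zs ! k)) ` {..<length hs})"
  have len: "length zs = length hs" using ev_comp.IH(1) by (auto dest: list_all2_lengthD)
  show ?case
  proof (rule reach_step[OF mono_eval_rule, of ?X])
    show "reach eval_rule (agrees g) x" if "x \<in> ?X" for x
      using that ev_comp.IH by (auto simp: list_all2_conv_all_nth)
    fix D assume D: "?X \<subseteq> set D"
    then have "(code f, zs, y) \<in> set D" by blast
    moreover have "\<forall>k<length zs. (hd (drop k (map code hs)), xs, hd (drop k zs)) \<in> set D"
      using D len by (auto simp: hd_drop_conv_nth)
    ultimately show "eval_rule D (code (Comp f hs), xs, y)"
      using len unfolding eval_rule_def
      by (auto simp: code_arg1_def code_arg2_def intro!: bexI[of _ "(code f, zs, y)"])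
  qed (simp_all add: agrees_def prod_encode_eq)
next
  case (ev_prim0 f xs y h)
  show ?case
  proof (rule reach_step[OF mono_eval_rule])
    show "reach eval_rule (agrees g) x" if "x \<in> {(code f, xs, y)}" for x
      using that ev_prim0 by simp
  qed (auto simp: eval_rule_def code_arg1_def agrees_def prod_encode_eq)
next
  case (ev_primS f h n xs z y)
  show ?case
  proof (rule reach_step[OF mono_eval_rule,
        of "{(code (Prim f h), n # xs, z), (code h, n # z # xs, y)}"])
    fix D assume D: "{(code (Prim f h), n # xs, z), (code h, n # z # xs, y)} \<subseteq> set D"
    then show "eval_rule D (code (Prim f h), Suc n # xs, y)"
      unfolding eval_rule_def
      by (auto simp: code_arg2_def intro!: bexI[of _ "(code (Prim f h), n # xs, z)"])
    next
    show "reach eval_rule (agrees g) x"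
      if "x \<in> {(code (Prim f h), n # xs, z), (code h, n # z # xs, y)}" for x
      using that ev_primS.IH by auto
  qed (auto simp: agrees_def prod_encode_eq)
next
  case (ev_mn f n xs)
  \<comment> \<open>Fixing one positive value for each \<open>m < n\<close> leaves a finite set of
    premises, as \<open>reach_step\<close> demands.\<close>
  have "\<forall>m. \<exists>v. m < n \<longrightarrow> 0 < v \<and> reach eval_rule (agrees g) (code f, m # xs, v)"
    using ev_mn.IH(2) by blast
  from choice[OF this] obtain v where
    v: "\<And>m. m < n \<Longrightarrow> 0 < v m \<and> reach eval_rule (agrees g) (code f, m # xs, v m)"
    by blast
  let ?X = "insert (code f, n # xs, 0) ((\<lambda>m. (code f, m # xs, v m)) ` {..<n})"
  show ?case
  proof (rule reach_step[OF mono_eval_rule, of ?X])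
    show "reach eval_rule (agrees g) x" if "x \<in> ?X" for x
      using that ev_mn.IH v by auto
    fix D assume D: "?X \<subseteq> set D"
    have "\<exists>q\<in>set D. fst q = code f \<and> fst (snd q) = m # xs \<and> 0 < snd (snd q)" if "m < n" for m
      using D v[OF that] that by (intro bexI[of _ "(code f, m # xs, v m)"]) auto
    then show "eval_rule D (code (Mn f), xs, n)"
      using D unfolding eval_rule_def by auto
  qed (simp_all add: agrees_def prod_encode_eq)
next
  case (ev_oracle x xs)
  show ?case
    by (rule reach_step[OF mono_eval_rule, of "{}"])
      (auto simp: eval_rule_def agrees_def)
qed (rule reach_step[OF mono_eval_rule, of "{}"];
    auto simp: eval_rule_def agrees_def prod_encode_eq hd_drop_conv_nth)+

text \<open>A normal form in the manner of Kleene: an existential quantifier over finite objects,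
  where the oracle enters only through \<open>agrees g\<close> and everything else is
  decidable.\<close>

lemma eval_iff_chain:
  "eval g t xs y \<longleftrightarrow> (\<exists>d. chain eval_rule d \<and> (\<forall>j\<in>set d. agrees g j) \<and> (code t, xs, y) \<in> set d)"
proof
  assume "eval g t xs y"
  from reach_eval[OF this]
  show "\<exists>d. chain eval_rule d \<and> (\<forall>j\<in>set d. agrees g j) \<and> (code t, xs, y) \<in> set d"
    by (simp add: reach_def)
next
  assume "\<exists>d. chain eval_rule d \<and> (\<forall>j\<in>set d. agrees g j) \<and> (code t, xs, y) \<in> set d"
  then obtain d where d: "chain eval_rule d" "\<forall>j\<in>set d. agrees g j" "(code t, xs, y) \<in> set d"
    by blast
  have "\<forall>t xs y. j = (code t, xs, y) \<longrightarrow> eval g t xs y" if "j \<in> set d" for j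
    using d(1) that
  proof (rule chain_induct)
    fix D j
    assume j: "j \<in> set d" "eval_rule D j"
      and D: "\<And>i. i \<in> set D \<Longrightarrow> \<forall>t xs y. i = (code t, xs, y) \<longrightarrow> eval g t xs y"
    show "\<forall>t xs y. j = (code t, xs, y) \<longrightarrow> eval g t xs y"
    proof (intro allI impI)
      fix t xs y assume eq: "j = (code t, xs, y)"
      show "eval g t xs y"
      proof (rule eval_rule_sound)
        show "eval_rule D (code t, xs, y)" using j(2) eq by simp
        show "y = g (hd xs)" if "t = Oracle"
          using bspec[OF d(2) j(1)] eq that by (simp add: agrees_def)
      qed (use D in blast)
    qed
  qed
  with d(3) show "eval g t xs y" by blast
qed

lemma halts_iff_chain:
  "(\<exists>y. eval g t [x] y) \<longleftrightarrow>
    (\<exists>q. chain eval_rule (snd q) \<and> (\<forall>j\<in>set (snd q). agrees g j) \<and> (code t, [x], fst q) \<in> set (snd q))"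
  by (simp only: eval_iff_chain split_paired_Ex fst_conv snd_conv)

lemma jump_iff_chain:
  "e \<in> jump g \<longleftrightarrow> e \<in> range code \<and>
    (\<exists>q. chain eval_rule (snd q) \<and> (\<forall>j\<in>set (snd q). agrees g j) \<and> (e, [e], fst q) \<in> set (snd q))"
proof -
  have "e \<in> jump g \<longleftrightarrow> (\<exists>t. e = code t \<and> (\<exists>y. eval g t [code t] y))"
    by (simp add: jump_def)
  also have "\<dots> \<longleftrightarrow> (\<exists>t. e = code t \<and>
      (\<exists>q. chain eval_rule (snd q) \<and> (\<forall>j\<in>set (snd q). agrees g j) \<and> (e, [e], fst q) \<in> set (snd q)))"
    unfolding halts_iff_chain by (intro ex_cong1 conj_cong refl) (simp only:)
  also have "(\<exists>t. e = code t \<and> R) \<longleftrightarrow> e \<in> range code \<and> R" for R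
    by blast
  finally show ?thesis .
qed

section \<open>Numbering of runs, and halting by a stage\<close>

lemma surj_enc_run: "surj (enc :: nat \<times> judgement list \<Rightarrow> nat)"
  by (intro surj_enc_prod surj_enc_list surj_enc_nat)

definition run_of :: "nat \<Rightarrow> nat \<times> judgement list" where
  "run_of = inv enc"

lemma computable_run_of [comp_intros]: "computable f \<Longrightarrow> computable (\<lambda>x. run_of (f x))"
  unfolding run_of_def by (rule computable_comp[OF computable_inv_enc[OF surj_enc_run]])

lemma run_of_enc: "run_of (enc q) = q"
  unfolding run_of_def by (rule inv_f_f, rule injI, erule enc_inj)

lemma Ex_run_of: "(\<exists>n. P (run_of n)) \<longleftrightarrow> (\<exists>q. P q)"
proof
  assume "\<exists>q. P q"
  then obtain q where "P q" ..
  then have "P (run_of (enc q))" by (simp only: run_of_enc)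
  then show "\<exists>n. P (run_of n)" ..
next
  assume "\<exists>n. P (run_of n)"
  then show "\<exists>q. P q" by (elim exE) (rule exI)
qed

lemma computable_agrees_empty: "computable (\<lambda>j. agrees (chr {}) j)"
  unfolding agrees_def chr_def code.simps empty_iff if_False by (intro comp_intros)

lemma computable_chain_eval_rule [comp_intros]:
  "computable f \<Longrightarrow> computable (\<lambda>x. chain eval_rule (f x))"
  by (rule computable_comp[OF computable_chain[OF computable_eval_rule]])

text \<open>The stage bounds the number of a run, not its length. The resulting approximation is
  decidable and monotone in \<open>s\<close>.\<close>

definition halts_by :: "nat \<Rightarrow> nat \<Rightarrow> nat \<Rightarrow> bool" where
  "halts_by m x s \<longleftrightarrow> (\<exists>n<s. chain eval_rule (snd (run_of n)) \<and>
    (\<forall>j\<in>set (snd (run_of n)). agrees (chr {}) j) \<and> (m, [x], fst (run_of n)) \<in> set (snd (run_of n)))"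

lemma computable_halts_by [comp_intros]:
  assumes "computable f" "computable g" "computable h"
  shows "computable (\<lambda>x. halts_by (f x) (g x) (h x))"
proof (rule computable_comp3[OF _ assms, where F=halts_by])
  show "computable (\<lambda>p. halts_by (fst p) (fst (snd p)) (snd (snd p)))"
    unfolding halts_by_def
    by (intro comp_intros computable_comp[OF computable_agrees_empty])
qed

lemma halts_by_mono: "halts_by m x s \<Longrightarrow> s \<le> s' \<Longrightarrow> halts_by m x s'"
  unfolding halts_by_def by (meson less_le_trans)

lemma halts_by_iff: "(\<exists>s. halts_by (code t) x s) \<longleftrightarrow> (\<exists>y. eval (chr {}) t [x] y)"
proof -
  have "(\<exists>s. halts_by (code t) x s) \<longleftrightarrow> (\<exists>n. chain eval_rule (snd (run_of n)) \<and>
      (\<forall>j\<in>set (snd (run_of n)). agrees (chr {}) j) \<and> (code t, [x], fst (run_of n)) \<in> set (snd (run_of n)))"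
    unfolding halts_by_def by blast
  also have "\<dots> \<longleftrightarrow> (\<exists>q. chain eval_rule (snd q) \<and> (\<forall>j\<in>set (snd q). agrees (chr {}) j) \<and>
      (code t, [x], fst q) \<in> set (snd q))"
    by (rule Ex_run_of)
  finally show ?thesis by (simp only: halts_iff_chain)
qed

lemma semidec_jump_empty: "semidec (\<lambda>e. e \<in> jump (chr {}))"
  unfolding jump_iff_chain
  by (intro semidec_conj semidec_range_code semidec_Ex_surj[OF surj_enc_run] semidec_computable
      comp_intros computable_comp[OF computable_agrees_empty])

text \<open>The Sigma_2 form of 0'', with \<open>n\<close> numbering runs relative to the halting
  set. Such a run is a derivation with finitely many oracle answers: an answer 1 is confirmed by
  enumerating the halting set, which goes into \<open>A\<close>; an answer 0 is refuted by
  enumerating it, which goes into \<open>B\<close>.\<close>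

lemma zero_jump2_sigma2:
  obtains A B :: "nat \<times> nat \<Rightarrow> bool"
  where "semidec A" "semidec B" "\<And>e. e \<in> zero_jump2 \<longleftrightarrow> (\<exists>n. A (e, n) \<and> \<not> B (e, n))"
proof
  let ?K = "jump (chr {})"
  let ?or = "\<lambda>j::judgement. fst j = prod_encode (6, 0)"
  define A where "A = (\<lambda>e n. e \<in> range code \<and> chain eval_rule (snd (run_of n)) \<and>
    (e, [e], fst (run_of n)) \<in> set (snd (run_of n)) \<and>
    (\<forall>j\<in>set (snd (run_of n)). \<not> ?or j \<or> snd (snd j) = 0 \<or> snd (snd j) = 1 \<and> hd (fst (snd j)) \<in> ?K))"
  define B where "B = (\<lambda>(e::nat) n. \<exists>j\<in>set (snd (run_of n)).
    (?or j \<and> snd (snd j) = 0) \<and> hd (fst (snd j)) \<in> ?K)"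
  show "semidec (case_prod A)"
    unfolding A_def case_prod_beta
    by (intro semidec_conj semidec_Ball_set semidec_disj semidec_comp[OF semidec_range_code]
        semidec_comp[OF semidec_jump_empty] comp_intros)
      (intro semidec_computable comp_intros)+
  show "semidec (case_prod B)"
    unfolding B_def case_prod_beta
    by (intro semidec_Bex_set semidec_conj[OF semidec_computable] semidec_comp[OF semidec_jump_empty]
        comp_intros)
  fix e
  \<comment> \<open>Correctness of one oracle answer splits into a c.e. condition and the negation
    of a c.e. condition.\<close>
  have "agrees (chr ?K) j \<longleftrightarrow>
      (\<not> ?or j \<or> snd (snd j) = 0 \<or> snd (snd j) = 1 \<and> hd (fst (snd j)) \<in> ?K) \<and>
      \<not> ((?or j \<and> snd (snd j) = 0) \<and> hd (fst (snd j)) \<in> ?K)" for j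
    by (auto simp: agrees_def chr_def)
  then have "(\<exists>n. A e n \<and> \<not> B e n) \<longleftrightarrow> e \<in> range code \<and> (\<exists>n. chain eval_rule (snd (run_of n)) \<and>
      (\<forall>j\<in>set (snd (run_of n)). agrees (chr ?K) j) \<and> (e, [e], fst (run_of n)) \<in> set (snd (run_of n)))"
    unfolding A_def B_def by (simp only: ball_conj_distrib) blast
  also have "\<dots> \<longleftrightarrow> e \<in> range code \<and> (\<exists>q. chain eval_rule (snd q) \<and>
      (\<forall>j\<in>set (snd q). agrees (chr ?K) j) \<and> (e, [e], fst q) \<in> set (snd q))"
    by (subst Ex_run_of[symmetric]) (rule refl)
  finally show "e \<in> zero_jump2 \<longleftrightarrow> (\<exists>n. case_prod A (e, n) \<and> \<not> case_prod B (e, n))"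
    by (simp only: zero_jump2_def jump_iff_chain prod.case)
qed

section \<open>Cantor space\<close>

definition seg :: "cantor \<Rightarrow> nat \<Rightarrow> bool list" where
  "seg X n = map X [0..<n]"

lemma length_seg [simp]: "length (seg X n) = n"
  by (simp add: seg_def)

lemma take_seg: "k \<le> n \<Longrightarrow> take k (seg X n) = seg X k"
  by (simp add: seg_def take_map take_upt)

lemma mem_cyl_iff: "X \<in> cyl \<sigma> \<longleftrightarrow> seg X (length \<sigma>) = \<sigma>"
  unfolding list_eq_iff_nth_eq[of "seg X (length \<sigma>)"] by (simp add: cyl_def seg_def)

lemma mem_cyl_seg [simp]: "X \<in> cyl (seg X n)"
  by (simp add: mem_cyl_iff)

lemma seg_append:
  assumes "X \<in> cyl \<sigma>" "length \<sigma> \<le> n"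
  shows "\<exists>\<rho>. seg X n = \<sigma> @ \<rho> \<and> length \<rho> = n - length \<sigma>"
proof -
  have *: "take (length \<sigma>) (seg X n) = \<sigma>"
    using assms by (simp add: take_seg mem_cyl_iff)
  have "seg X n = take (length \<sigma>) (seg X n) @ drop (length \<sigma>) (seg X n)"
    by (rule append_take_drop_id[symmetric])
  also have "\<dots> = \<sigma> @ drop (length \<sigma>) (seg X n)"
    by (simp only: *)
  finally have "seg X n = \<sigma> @ drop (length \<sigma>) (seg X n)" .
  moreover have "length (drop (length \<sigma>) (seg X n)) = n - length \<sigma>" by simp
  ultimately show ?thesis by (intro exI conjI)
qed

section \<open>Strings of a given length, compactness and effectively open sets\<close>

primrec strings :: "nat \<Rightarrow> bool list list" where
  "strings 0 = [[]]"
| "strings (Suc n) = map (Cons True) (strings n) @ map (Cons False) (strings n)"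

lemma set_strings: "set (strings n) = {\<tau>. length \<tau> = n}"
proof (induction n)
  case (Suc n)
  show ?case
  proof (rule set_eqI)
    show "\<tau> \<in> set (strings (Suc n)) \<longleftrightarrow> \<tau> \<in> {\<tau>. length \<tau> = Suc n}" for \<tau>
      by (cases \<tau>; cases "hd \<tau>") (auto simp: Suc image_iff)
  qed
qed simp

lemma distinct_strings: "distinct (strings n)"
  by (induction n) (auto simp: distinct_map)

lemma computable_strings [comp_intros]:
  assumes "computable f"
  shows "computable (\<lambda>x. strings (f x))"
proof -
  have "rec_nat [[]] (\<lambda>_ L. map (Cons True) L @ map (Cons False) L) n = strings n" for n
    by (induction n) auto
  moreover have "computable (\<lambda>x. rec_nat [[]] (\<lambda>_ L. map (Cons True) L @ map (Cons False) L) (f x))"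
    by (intro comp_intros assms)
  ultimately show ?thesis by simp
qed

lemma str_code_eq_enc: "str_code \<sigma> = enc \<sigma>"
  by (simp add: str_code_def enc_list_def enc_bool_def[abs_def])

lemma computable_str_code [comp_intros]: "computable f \<Longrightarrow> computable (\<lambda>x. str_code (f x))"
  unfolding str_code_eq_enc by (rule computable_enc)

text \<open>Koenig's lemma. If no \<open>N\<close> works, then \<open>\<sigma>\<close> has
  arbitrarily long extensions without a prefix in \<open>S\<close>; one of the two successors
  inherits this, and the path so obtained is a point of \<open>cyl \<sigma>\<close> that is not
  covered.\<close>

lemma cyl_compact:
  assumes cov: "\<And>X. X \<in> cyl \<sigma> \<Longrightarrow> \<exists>n. S (seg X n)"
  shows "\<exists>N. \<forall>\<rho>. N \<le> length \<rho> \<longrightarrow> (\<exists>k\<le>length (\<sigma> @ \<rho>). S (take k (\<sigma> @ \<rho>)))"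
proof (rule ccontr)
  define bad where
    "bad \<tau> \<longleftrightarrow> (\<forall>N. \<exists>\<rho>. N \<le> length \<rho> \<and> (\<forall>k\<le>length (\<tau> @ \<rho>). \<not> S (take k (\<tau> @ \<rho>))))" for \<tau>
  assume "\<not> ?thesis"
  then have bad0: "bad \<sigma>" unfolding bad_def by blast
  have step: "\<exists>b. bad (\<tau> @ [b])" if "bad \<tau>" for \<tau>
  proof (rule ccontr)
    assume "\<nexists>b. bad (\<tau> @ [b])"
    then have "\<forall>b. \<exists>N. \<forall>\<rho>. N \<le> length \<rho> \<longrightarrow>
        (\<exists>k\<le>length ((\<tau> @ [b]) @ \<rho>). S (take k ((\<tau> @ [b]) @ \<rho>)))"
      unfolding bad_def by blast
    from choice[OF this] obtain N where N: "\<And>b \<rho>. N b \<le> length \<rho> \<Longrightarrow>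
        \<exists>k\<le>length ((\<tau> @ [b]) @ \<rho>). S (take k ((\<tau> @ [b]) @ \<rho>))"
      by blast
    \<comment> \<open>The successor \<open>Suc\<close> pays for the first bit of the extension,
      which selects the child.\<close>
    obtain \<rho> where \<rho>: "Suc (max (N True) (N False)) \<le> length \<rho>"
      "\<forall>k\<le>length (\<tau> @ \<rho>). \<not> S (take k (\<tau> @ \<rho>))"
      using \<open>bad \<tau>\<close> unfolding bad_def by blast
    then obtain b \<rho>' where "\<rho> = b # \<rho>'" by (cases \<rho>) auto
    with \<rho> N[of b \<rho>'] show False by (cases b) auto
  qed
  define ext where "ext \<tau> = \<tau> @ [SOME b. bad (\<tau> @ [b])]" for \<tau>
  define f where "f n = (ext ^^ n) \<sigma>" for n
  have f_Suc: "f (Suc n) = f n @ [SOME b. bad (f n @ [b])]" for n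
    by (simp add: f_def ext_def)
  have bad_f: "bad (f n)" for n
  proof (induction n)
    case (Suc n)
    show ?case unfolding f_Suc by (rule someI_ex[OF step[OF Suc]])
  qed (simp add: f_def bad0)
  have len: "length (f n) = length \<sigma> + n" for n
    by (induction n) (auto simp: f_Suc, simp add: f_def)
  have prefix: "f n ! i = f m ! i" if "n \<le> m" "i < length \<sigma> + n" for n m i
    using that by (induction m rule: dec_induct) (auto simp: f_Suc nth_append len)
  \<comment> \<open>Position \<open>i\<close> is settled in \<open>f (Suc i)\<close>, whose length
    exceeds \<open>i\<close>; later strings extend it.\<close>
  define X where "X i = f (Suc i) ! i" for i
  have seg: "seg X (length \<sigma> + n) = f n" for n
  proof (rule nth_equalityI)
    fix i assume i: "i < length (seg X (length \<sigma> + n))"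
    have "f (Suc i) ! i = f n ! i"
    proof (cases "n \<le> Suc i")
      case True
      then show ?thesis using i by (intro prefix[symmetric]) auto
    next
      case False
      then show ?thesis by (intro prefix) auto
    qed
    then show "seg X (length \<sigma> + n) ! i = f n ! i"
      using i by (simp add: seg_def X_def)
  qed (simp add: len)
  have "X \<in> cyl \<sigma>" using seg[of 0] by (simp add: mem_cyl_iff f_def)
  then obtain m where m: "S (seg X m)" using cov by blast
  obtain \<rho> where "\<forall>k\<le>length (f m @ \<rho>). \<not> S (take k (f m @ \<rho>))"
    using bad_f[of m] unfolding bad_def by blast
  moreover have "m \<le> length (f m @ \<rho>)" by (simp add: len)
  ultimately have "\<not> S (take m (f m @ \<rho>))" by blast
  moreover have "take m (f m @ \<rho>) = seg X m"
    using take_seg[of m "length \<sigma> + m" X] by (simp add: seg len)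
  ultimately show False using m by simp
qed

text \<open>\<open>unif_eff_open\<close> asks for an enumeration of all cylinders inside the set,
  not merely of some that generate it. By compactness an inclusion is witnessed at one finite level,
  hence is semidecidable along with \<open>S\<close>.\<close>

lemma cyl_subset_iff:
  "cyl \<sigma> \<subseteq> {X. \<exists>n. S (seg X n)} \<longleftrightarrow>
    (\<exists>N. \<forall>\<rho>\<in>set (strings N). \<exists>k\<le>length (\<sigma> @ \<rho>). S (take k (\<sigma> @ \<rho>)))"
proof
  assume "cyl \<sigma> \<subseteq> {X. \<exists>n. S (seg X n)}"
  then have "\<exists>N. \<forall>\<rho>. N \<le> length \<rho> \<longrightarrow> (\<exists>k\<le>length (\<sigma> @ \<rho>). S (take k (\<sigma> @ \<rho>)))"
    by (intro cyl_compact) blast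
  then obtain N where "\<And>\<rho>. N \<le> length \<rho> \<Longrightarrow> \<exists>k\<le>length (\<sigma> @ \<rho>). S (take k (\<sigma> @ \<rho>))"
    by blast
  then have "\<forall>\<rho>\<in>set (strings N). \<exists>k\<le>length (\<sigma> @ \<rho>). S (take k (\<sigma> @ \<rho>))"
    unfolding set_strings mem_Collect_eq Ball_def by (intro allI impI) (simp only: order_refl)
  then show "\<exists>N. \<forall>\<rho>\<in>set (strings N). \<exists>k\<le>length (\<sigma> @ \<rho>). S (take k (\<sigma> @ \<rho>))" ..
next
  assume "\<exists>N. \<forall>\<rho>\<in>set (strings N). \<exists>k\<le>length (\<sigma> @ \<rho>). S (take k (\<sigma> @ \<rho>))"
  then obtain N where N: "\<And>\<rho>. length \<rho> = N \<Longrightarrow> \<exists>k\<le>length (\<sigma> @ \<rho>). S (take k (\<sigma> @ \<rho>))"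
    by (auto simp: set_strings)
  show "cyl \<sigma> \<subseteq> {X. \<exists>n. S (seg X n)}"
  proof
    fix X assume "X \<in> cyl \<sigma>"
    then obtain \<rho> where "seg X (length \<sigma> + N) = \<sigma> @ \<rho>" "length \<rho> = N"
      using seg_append[of X \<sigma> "length \<sigma> + N"] by auto
    with N[of \<rho>] obtain k where "k \<le> length \<sigma> + N" "S (take k (seg X (length \<sigma> + N)))"
      by (metis length_append)
    then have "S (seg X k)" by (simp add: take_seg)
    then show "X \<in> {X. \<exists>n. S (seg X n)}" by blast
  qed
qed

text \<open>The encoding of bit strings is not surjective, so a search for a string is run over
  numbers, each of which is made to denote some string.\<close>

definition string_of :: "nat \<Rightarrow> bool list" where
  "string_of n = map (\<lambda>k. k \<noteq> 0) (list_decode n)"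

lemma string_of_str_code [simp]: "string_of (str_code \<sigma>) = \<sigma>"
  by (simp add: string_of_def str_code_def o_def)

lemma computable_string_of [comp_intros]:
  "computable f \<Longrightarrow> computable (\<lambda>x. string_of (f x))"
  unfolding string_of_def by (intro comp_intros)

lemma unif_eff_openI:
  assumes S: "semidec (\<lambda>p. S (fst p) (snd p))"
    and U: "\<And>i. U i = {X. \<exists>n. S i (seg X n)}"
  shows "unif_eff_open U"
  unfolding unif_eff_open_def
proof (intro conjI allI)
  show "cantor_open (U i)" for i
    unfolding cantor_open_def
  proof
    fix X assume "X \<in> U i"
    then obtain n where n: "S i (seg X n)" by (auto simp: U)
    have "cyl (seg X n) \<subseteq> U i"
    proof
      fix Y assume "Y \<in> cyl (seg X n)"
      then have "seg Y n = seg X n" by (simp add: mem_cyl_iff)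
      with n show "Y \<in> U i" by (auto simp: U intro: exI[of _ n])
    qed
    then show "\<exists>\<sigma>. X \<in> cyl \<sigma> \<and> cyl \<sigma> \<subseteq> U i" by (intro exI[of _ "seg X n"]) simp
  qed
  let ?P = "\<lambda>x. \<exists>i c. x = prod_encode (i, str_code (string_of c)) \<and> cyl (string_of c) \<subseteq> U i"
  have "{prod_encode (i, str_code \<sigma>) |i \<sigma>. cyl \<sigma> \<subseteq> U i} = {x. ?P x}" (is "?L = _")
  proof (intro set_eqI iffI)
    fix x assume "x \<in> ?L"
    then obtain i \<sigma> where "x = prod_encode (i, str_code \<sigma>)" "cyl \<sigma> \<subseteq> U i" by blast
    then have "x = prod_encode (i, str_code (string_of (str_code \<sigma>))) \<and> cyl (string_of (str_code \<sigma>)) \<subseteq> U i"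
      by simp
    then show "x \<in> {x. ?P x}" by blast
  qed blast
  moreover have "semidec ?P"
    unfolding U cyl_subset_iff
    by (intro semidec_Ex semidec_conj semidec_Ball_set semidec_comp2[OF S] comp_intros)
      (intro semidec_computable comp_intros)+
  ultimately show "ce {prod_encode (i, str_code \<sigma>) |i \<sigma>. cyl \<sigma> \<subseteq> U i}"
    by (simp only: ce_Collect_semidec)
qed

section \<open>Lebesgue measure of sets given by prefixes\<close>

interpretation coin: product_prob_space "\<lambda>_::nat. measure_pmf (bernoulli_pmf (1/2))" UNIV
  by standard

interpretation lambda: prob_space lambda_measure
  unfolding lambda_measure_def by (rule coin.prob_space_axioms)

lemma space_lambda [simp]: "space lambda_measure = UNIV"
  by (simp add: lambda_measure_def space_PiM)

lemma cyl_prod_emb: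
  "cyl \<sigma> = prod_emb UNIV (\<lambda>_. measure_pmf (bernoulli_pmf (1/2))) {..<length \<sigma>}
    (\<Pi>\<^sub>E i\<in>{..<length \<sigma>}. {\<sigma> ! i})"
  by (auto simp: cyl_def prod_emb_def PiE_iff restrict_def extensional_def)

lemma cyl_sets [measurable]: "cyl \<sigma> \<in> sets lambda_measure"
  unfolding lambda_measure_def cyl_prod_emb by (intro sets_PiM_I) auto

lemma measure_cyl: "measure lambda_measure (cyl \<sigma>) = (1/2) ^ length \<sigma>"
proof -
  have "measure lambda_measure (cyl \<sigma>) =
      (\<Prod>i<length \<sigma>. measure (measure_pmf (bernoulli_pmf (1/2))) {\<sigma> ! i})"
    unfolding lambda_measure_def cyl_prod_emb by (intro coin.measure_PiM_emb) auto
  also have "\<dots> = (\<Prod>i<length \<sigma>. 1/2)"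
    by (intro prod.cong refl) (simp add: measure_pmf_single)
  finally show ?thesis by (simp add: power_divide)
qed

lemma Collect_seg_eq: "{X. P (seg X n)} = (\<Union>\<tau>\<in>{\<tau>. length \<tau> = n \<and> P \<tau>}. cyl \<tau>)"
  by (auto simp: mem_cyl_iff)

lemma finite_strings: "finite {\<tau>::bool list. length \<tau> = n \<and> P \<tau>}"
  using finite_lists_length_eq[of "UNIV :: bool set" n] by (auto intro: finite_subset)

lemma sets_seg: "{X. P (seg X n)} \<in> sets lambda_measure"
  unfolding Collect_seg_eq by (intro sets.finite_UN finite_strings cyl_sets)

lemma sets_Ex_seg: "{X. \<exists>n. S n (seg X n)} \<in> sets lambda_measure"
proof -
  have "{X. \<exists>n. S n (seg X n)} = (\<Union>n. {X. S n (seg X n)})" by auto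
  also have "\<dots> \<in> sets lambda_measure" by (intro sets.countable_UN) (auto simp: sets_seg)
  finally show ?thesis .
qed

text \<open>Turns measure into a count of strings; \<open>admissible\<close> can decide its bound on
  the measure because of this.\<close>

lemma measure_seg:
  "measure lambda_measure {X. P (seg X n)} = real (length (filter P (strings n))) / 2 ^ n"
proof -
  let ?T = "{\<tau>. length \<tau> = n \<and> P \<tau>}"
  have "measure lambda_measure {X. P (seg X n)} = (\<Sum>\<tau>\<in>?T. measure lambda_measure (cyl \<tau>))"
    unfolding Collect_seg_eq
    by (intro lambda.finite_measure_finite_Union finite_strings)
      (auto simp: disjoint_family_on_def mem_cyl_iff)
  also have "\<dots> = real (card ?T) * (1/2) ^ n"
    by (simp add: measure_cyl)
  also have "?T = set (filter P (strings n))" by (auto simp: set_strings)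
  also have "card \<dots> = length (filter P (strings n))"
    by (intro distinct_card distinct_filter distinct_strings)
  finally show ?thesis by (simp add: power_divide)
qed

lemma measure_UN_le:
  assumes "\<And>n. A n \<in> sets lambda_measure" "\<And>n. measure lambda_measure (A n) \<le> c * (1/2) ^ n"
  shows "measure lambda_measure (\<Union>n. A n) \<le> 2 * c"
proof -
  have s: "(\<lambda>n. c * (1/2) ^ n) sums (c * (1 / (1 - 1/2)))"
    by (intro sums_mult geometric_sums) simp
  have sm: "summable (\<lambda>n. measure lambda_measure (A n))"
    by (rule summable_comparison_test'[OF sums_summable[OF s], of 0]) (use assms(2) in auto)
  have "measure lambda_measure (\<Union>n. A n) \<le> (\<Sum>n. measure lambda_measure (A n))"
    using assms(1) by (intro lambda.finite_measure_subadditive_countably sm) auto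
  also have "\<dots> \<le> (\<Sum>n. c * (1/2) ^ n)"
    by (intro suminf_le assms(2) sm sums_summable[OF s])
  also have "\<dots> = 2 * c" using sums_unique[OF s] by simp
  finally show ?thesis .
qed

lemma sets_cantor_open:
  assumes "cantor_open U"
  shows "U \<in> sets lambda_measure"
proof -
  have "U = {X. \<exists>n. cyl (seg X n) \<subseteq> U}"
  proof (intro set_eqI iffI)
    fix X assume "X \<in> U"
    then obtain \<sigma> where "X \<in> cyl \<sigma>" "cyl \<sigma> \<subseteq> U" using assms unfolding cantor_open_def by blast
    then show "X \<in> {X. \<exists>n. cyl (seg X n) \<subseteq> U}"
      by (auto simp: mem_cyl_iff intro!: exI[of _ "length \<sigma>"])
  next
    fix X assume "X \<in> {X. \<exists>n. cyl (seg X n) \<subseteq> U}"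
    then show "X \<in> U" using mem_cyl_seg by blast
  qed
  then show ?thesis using sets_Ex_seg[of "\<lambda>_ \<tau>. cyl \<tau> \<subseteq> U"] by simp
qed

section \<open>The tests\<close>

text \<open>The bound on \<open>k\<close> lets stage \<open>s\<close> depend on the first
  \<open>s\<close> bits alone (\<open>covered_take\<close>), so each stage is a finite set of
  strings of length \<open>s\<close>.\<close>

definition covered :: "nat \<Rightarrow> nat \<Rightarrow> nat \<Rightarrow> bool list \<Rightarrow> bool" where
  "covered m i s \<tau> \<longleftrightarrow> (\<exists>k\<le>s. halts_by m (prod_encode (i, str_code (take k \<tau>))) s)"

text \<open>Using machine \<open>m\<close> only at its admissible stages trims it to a test, and changes nothing if it
  enumerates one already.\<close>

definition admissible :: "nat \<Rightarrow> nat \<Rightarrow> nat \<Rightarrow> bool" where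
  "admissible m i s \<longleftrightarrow> length (filter (covered m i s) (strings s)) * 2 ^ i \<le> 2 ^ s"

text \<open>Because of \<open>e < s\<close> only finitely many indices act at each stage, and
  \<open>fresh\<close> can check them all.\<close>

definition hit :: "nat \<Rightarrow> nat \<Rightarrow> bool list \<Rightarrow> bool" where
  "hit e s \<tau> \<longleftrightarrow> e < s \<and> (\<exists>m<s. admissible m (e + m + 4) s \<and> covered m (e + m + 4) s \<tau>)"

definition fresh :: "nat \<Rightarrow> bool list list \<Rightarrow> bool list \<Rightarrow> bool" where
  "fresh n L \<tau> \<longleftrightarrow> (\<forall>\<rho>\<in>set L. take (length \<rho>) \<tau> \<noteq> \<rho>) \<and> (\<forall>s\<le>n. \<forall>e<s. \<not> hit e s \<tau>)"

text \<open>The recursion carries the whole list since freshness refers to all earlier holes. That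
  \<open>hd\<close> finds a fresh string is proved in \<open>length_fresh_hole\<close>.\<close>

primrec holes :: "nat \<Rightarrow> bool list list" where
  "holes 0 = []"
| "holes (Suc n) = holes n @ [hd (filter (fresh n (holes n)) (strings (n + 3)))]"

definition hole :: "nat \<Rightarrow> bool list" where
  "hole n = hd (filter (fresh n (holes n)) (strings (n + 3)))"

lemma computable_covered [comp_intros]:
  fixes f g h :: "'a::enc \<Rightarrow> nat"
  assumes "computable f" "computable g" "computable h" "computable t"
  shows "computable (\<lambda>x. covered (f x) (g x) (h x) (t x))"
  unfolding covered_def by (intro comp_intros assms assms[THEN computable_comp])

lemma computable_admissible [comp_intros]:
  fixes f g h :: "'a::enc \<Rightarrow> nat"
  assumes "computable f" "computable g" "computable h"
  shows "computable (\<lambda>x. admissible (f x) (g x) (h x))"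
  unfolding admissible_def by (intro comp_intros assms assms[THEN computable_comp])

lemma computable_hit [comp_intros]:
  fixes f g :: "'a::enc \<Rightarrow> nat"
  assumes "computable f" "computable g" "computable t"
  shows "computable (\<lambda>x. hit (f x) (g x) (t x))"
  unfolding hit_def by (intro comp_intros assms assms[THEN computable_comp])

lemma computable_fresh [comp_intros]:
  fixes f :: "'a::enc \<Rightarrow> nat"
  assumes "computable f" "computable L" "computable t"
  shows "computable (\<lambda>x. fresh (f x) (L x) (t x))"
  unfolding fresh_def by (intro comp_intros assms assms[THEN computable_comp])

lemma computable_holes [comp_intros]:
  assumes "computable f"
  shows "computable (\<lambda>x. holes (f x))"
proof -
  have "rec_nat [] (\<lambda>n L. L @ [hd (filter (fresh n L) (strings (n + 3)))]) n = holes n" for n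
    by (induction n) auto
  moreover have "computable (\<lambda>x. rec_nat [] (\<lambda>n L. L @ [hd (filter (fresh n L) (strings (n + 3)))]) (f x))"
    by (intro comp_intros assms)
  ultimately show ?thesis by simp
qed

lemma computable_hole [comp_intros]:
  assumes "computable f"
  shows "computable (\<lambda>x. hole (f x))"
  unfolding hole_def by (intro comp_intros assms assms[THEN computable_comp])

section \<open>Stages and measure of the trimmed tests\<close>

lemma covered_take: "covered m i s (take s \<tau>) \<longleftrightarrow> covered m i s \<tau>"
  unfolding covered_def by (intro ex_cong1 conj_cong refl) (simp add: min_absorb1)

lemma hit_take: "hit e s (take s \<tau>) \<longleftrightarrow> hit e s \<tau>"
  unfolding hit_def covered_take ..

lemma covered_seg:
  "covered m i s (seg X s) \<longleftrightarrow> (\<exists>k\<le>s. halts_by m (prod_encode (i, str_code (seg X k))) s)"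
  unfolding covered_def by (intro ex_cong1 conj_cong refl) (simp add: take_seg)

lemma hit_seg: "s \<le> n \<Longrightarrow> hit e s (seg X n) \<longleftrightarrow> hit e s (seg X s)"
  using hit_take[of e s "seg X n"] by (simp add: take_seg)

lemma covered_mono:
  assumes "covered m i s (seg X s)" "s \<le> s'"
  shows "covered m i s' (seg X s')"
proof -
  from assms(1) obtain k where "k \<le> s" "halts_by m (prod_encode (i, str_code (seg X k))) s"
    unfolding covered_seg by blast
  with assms(2) show ?thesis
    unfolding covered_seg by (intro exI[of _ k] conjI halts_by_mono[of _ _ s s']) auto
qed

lemma admissible_iff: "admissible m i s \<longleftrightarrow> measure lambda_measure {X. covered m i s (seg X s)} \<le> (1/2) ^ i"
proof -
  define a where "a = length (filter (covered m i s) (strings s))"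
  have "real a / 2 ^ s \<le> (1/2) ^ i \<longleftrightarrow> real a * 2 ^ i \<le> 2 ^ s"
    by (simp add: power_one_over divide_simps mult.commute)
  also have "\<dots> \<longleftrightarrow> real (a * 2 ^ i) \<le> real (2 ^ s)" by simp
  also have "\<dots> \<longleftrightarrow> a * 2 ^ i \<le> 2 ^ s" by (rule of_nat_le_iff)
  finally show ?thesis unfolding measure_seg admissible_def a_def by (rule sym)
qed

text \<open>Covered sets grow with the stage. Up to stage \<open>s\<close> the union therefore lies
  in the covered set of the last admissible stage, which is small by admissibility; continuity from
  below does the rest.\<close>

lemma measure_admissible_le:
  "measure lambda_measure {X. \<exists>s. admissible m i s \<and> covered m i s (seg X s)} \<le> (1/2) ^ i"
proof -
  define C where "C s = {X. covered m i s (seg X s)}" for s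
  define D where "D s = {X. \<exists>s'\<le>s. admissible m i s' \<and> covered m i s' (seg X s')}" for s
  have C: "measure lambda_measure (C s) \<le> (1/2) ^ i" if "admissible m i s" for s
    using that by (simp add: admissible_iff C_def)
  have D: "measure lambda_measure (D s) \<le> (1/2) ^ i" for s
  proof (cases "\<exists>s'\<le>s. admissible m i s'")
    case True
    define t where "t = Max {s'. s' \<le> s \<and> admissible m i s'}"
    have fin: "finite {s'. s' \<le> s \<and> admissible m i s'}" by simp
    have t: "admissible m i t" "\<And>s'. s' \<le> s \<Longrightarrow> admissible m i s' \<Longrightarrow> s' \<le> t"
      using Max_in[OF fin] Max_ge[OF fin] True unfolding t_def by auto
    have "D s \<subseteq> C t" unfolding D_def C_def using t(2) covered_mono by blast
    then have "measure lambda_measure (D s) \<le> measure lambda_measure (C t)"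
      unfolding C_def by (intro lambda.finite_measure_mono sets_seg)
    with C[OF t(1)] show ?thesis by simp
  next
    case False
    then have "D s = {}" by (auto simp: D_def)
    then show ?thesis by simp
  qed
  have "(\<lambda>s. measure lambda_measure (D s)) \<longlonglongrightarrow> measure lambda_measure (\<Union>s. D s)"
  proof (rule lambda.finite_Lim_measure_incseq)
    have "D s = (\<Union>s'\<in>{s'. s' \<le> s \<and> admissible m i s'}. {X. covered m i s' (seg X s')})" for s
      by (auto simp: D_def)
    then show "range D \<subseteq> sets lambda_measure"
      by (auto intro!: sets.finite_UN sets_seg)
    show "incseq D" unfolding incseq_def D_def by (auto intro: order_trans)
  qed
  then have "measure lambda_measure (\<Union>s. D s) \<le> (1/2) ^ i"
    by (rule LIMSEQ_le_const2) (use D in blast)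
  moreover have "(\<Union>s. D s) = {X. \<exists>s. admissible m i s \<and> covered m i s (seg X s)}"
    by (auto simp: D_def)
  ultimately show ?thesis by simp
qed

definition hits :: "nat \<Rightarrow> cantor set" where
  "hits e = {X. \<exists>s. hit e s (seg X s)}"

lemma sets_hits: "hits e \<in> sets lambda_measure"
  unfolding hits_def by (rule sets_Ex_seg)

lemma measure_hits_le: "measure lambda_measure (hits e) \<le> (1/2) ^ e / 8"
proof -
  let ?A = "\<lambda>m. {X. \<exists>s. admissible m (e + m + 4) s \<and> covered m (e + m + 4) s (seg X s)}"
  have A: "?A m \<in> sets lambda_measure" for m
    using sets_Ex_seg[of "\<lambda>s \<tau>. admissible m (e + m + 4) s \<and> covered m (e + m + 4) s \<tau>"] .
  have "hits e \<subseteq> (\<Union>m. ?A m)" unfolding hits_def hit_def by blast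
  then have "measure lambda_measure (hits e) \<le> measure lambda_measure (\<Union>m. ?A m)"
    by (intro lambda.finite_measure_mono sets.countable_UN) (use A in auto)
  \<comment> \<open>The 16 comes from the offset 4 in \<open>hit\<close>, the factor 2 from summing
    over \<open>m\<close>.\<close>
  also have "\<dots> \<le> 2 * ((1/2) ^ e / 16)"
  proof (rule measure_UN_le)
    show "measure lambda_measure (?A m) \<le> (1/2) ^ e / 16 * (1/2) ^ m" for m
      using measure_admissible_le[of m "e + m + 4"] by (simp add: power_add power3_eq_cube power4_eq_xxxx)
  qed (rule A)
  finally show ?thesis by simp
qed

section \<open>Existence and disjointness of the holes\<close>

lemma holes_eq: "holes n = map hole [0..<n]"
  by (induction n) (auto simp: hole_def)

text \<open>The earlier holes have total measure at most 1/4, and so do all the sets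
  \<open>hits e\<close> together. Some point \<open>X\<close> avoids both, and its prefix of length
  \<open>n + 3\<close> is fresh.\<close>

lemma length_fresh_hole: "length (hole n) = n + 3 \<and> fresh n (holes n) (hole n)"
proof (induction n rule: less_induct)
  case (less n)
  \<comment> \<open>Padding with empty sets gives the countable union that
    \<open>measure_UN_le\<close> expects.\<close>
  let ?H = "\<Union>k. if k < n then cyl (hole k) else {}"
  have "measure lambda_measure ?H \<le> 2 * (1/8)"
    by (rule measure_UN_le) (use less in \<open>auto simp: cyl_sets measure_cyl power_add power3_eq_cube\<close>)
  moreover have "measure lambda_measure (\<Union>e. hits e) \<le> 2 * (1/8)"
    by (rule measure_UN_le) (use measure_hits_le in \<open>auto simp: sets_hits\<close>)
  moreover have H: "?H \<in> sets lambda_measure"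
    by (intro sets.countable_UN) (auto simp: cyl_sets)
  moreover have E: "(\<Union>e. hits e) \<in> sets lambda_measure"
    by (intro sets.countable_UN) (auto simp: sets_hits)
  ultimately have "measure lambda_measure (?H \<union> (\<Union>e. hits e)) < 1"
    using measure_Un_le[OF H E] by linarith
  moreover have "measure lambda_measure UNIV = 1"
    using lambda.prob_space by simp
  ultimately have "?H \<union> (\<Union>e. hits e) \<noteq> UNIV"
    by (metis less_irrefl)
  then obtain X where X: "X \<notin> ?H" "\<And>e. X \<notin> hits e" by blast
  have "fresh n (holes n) (seg X (n + 3))"
    unfolding fresh_def
  proof (intro conjI ballI allI impI)
    fix \<rho> assume "\<rho> \<in> set (holes n)"
    then obtain k where k: "k < n" "\<rho> = hole k" by (auto simp: holes_eq)
    then have "length \<rho> \<le> n + 3" using less by simp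
    moreover have "X \<notin> cyl \<rho>" using X(1) k by (simp add: UN_iff)
    ultimately show "take (length \<rho>) (seg X (n + 3)) \<noteq> \<rho>"
      by (simp add: take_seg mem_cyl_iff)
  next
    fix s e assume "s \<le> n" "e < s"
    then show "\<not> hit e s (seg X (n + 3))"
      using X(2)[of e] by (auto simp: hits_def hit_seg[of s "n + 3"])
  qed
  then have "seg X (n + 3) \<in> set (filter (fresh n (holes n)) (strings (n + 3)))"
    by (simp only: set_filter set_strings mem_Collect_eq length_seg simp_thms)
  then have "filter (fresh n (holes n)) (strings (n + 3)) \<noteq> []"
    by (auto simp only: list.set empty_iff)
  from hd_in_set[OF this] have "hole n \<in> set (filter (fresh n (holes n)) (strings (n + 3)))"
    unfolding hole_def .
  then show ?case
    by (simp only: set_filter set_strings mem_Collect_eq simp_thms)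
qed

lemma length_hole [simp]: "length (hole n) = n + 3"
  and fresh_hole: "fresh n (holes n) (hole n)"
  using length_fresh_hole by auto

lemma hole_not_hit:
  assumes "s \<le> n"
  shows "\<not> hit e s (hole n)"
proof
  assume hit: "hit e s (hole n)"
  then have "e < s" unfolding hit_def by (rule conjunct1)
  moreover have "\<forall>s\<le>n. \<forall>e<s. \<not> hit e s (hole n)"
    using fresh_hole[of n] unfolding fresh_def by (rule conjunct2)
  ultimately show False using assms hit by simp
qed

lemma take_hole:
  assumes "m < n"
  shows "take (m + 3) (hole n) \<noteq> hole m"
proof -
  have "\<forall>\<rho>\<in>set (holes n). take (length \<rho>) (hole n) \<noteq> \<rho>"
    using fresh_hole[of n] unfolding fresh_def by (rule conjunct1)
  moreover have "hole m \<in> set (holes n)" using assms by (simp add: holes_eq)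
  ultimately have "take (length (hole m)) (hole n) \<noteq> hole m" by (rule bspec)
  then show ?thesis by simp
qed

lemma cyl_hole_disjoint:
  assumes "X \<in> cyl (hole m)" "X \<in> cyl (hole n)"
  shows "m = n"
proof -
  have eq: "seg X (m + 3) = hole m" "seg X (n + 3) = hole n"
    using assms by (simp_all add: mem_cyl_iff)
  have "\<not> m < n"
    using take_hole[of m n] take_seg[of "m + 3" "n + 3" X] unfolding eq by linarith
  moreover have "\<not> n < m"
    using take_hole[of n m] take_seg[of "n + 3" "m + 3" X] unfolding eq by linarith
  ultimately show ?thesis by simp
qed

text \<open>Prefix form of \<open>W\<close>, decidable apart from \<open>Q\<close>. The length
  condition \<open>n + 3 \<le> length \<tau>\<close> ensures that the prefix already decides
  membership in hole \<open>n\<close>.\<close>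

definition W_str :: "(nat \<Rightarrow> nat \<Rightarrow> bool) \<Rightarrow> nat \<Rightarrow> bool list \<Rightarrow> bool" where
  "W_str Q e \<tau> \<longleftrightarrow>
    (\<exists>s\<le>length \<tau>. hit e s \<tau> \<and> (\<forall>n<s. n + 3 \<le> length \<tau> \<and> take (n + 3) \<tau> \<noteq> hole n)) \<or>
    (\<exists>n\<le>length \<tau>. n + 3 \<le> length \<tau> \<and> take (n + 3) \<tau> = hole n \<and>
      (\<exists>s\<le>length \<tau>. hit (e + n + 3) s \<tau>)) \<or>
    (\<exists>n. Q e n \<and> \<tau> = hole n)"

text \<open>The first part is \<open>hits e\<close> without all holes: a hole with number
  \<open>n \<ge> s\<close> is fresh for stage \<open>s\<close> and contains no point hit then.
  Testing only the finitely many holes \<open>n < s\<close> keeps this part open.\<close>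

definition W :: "(nat \<Rightarrow> nat \<Rightarrow> bool) \<Rightarrow> nat \<Rightarrow> cantor set" where
  "W Q e = {X. \<exists>s. hit e s (seg X s) \<and> (\<forall>n<s. X \<notin> cyl (hole n))}
    \<union> (\<Union>n. cyl (hole n) \<inter> hits (e + n + 3))
    \<union> (\<Union>n\<in>{n. Q e n}. cyl (hole n))"

definition V :: "nat \<Rightarrow> cantor set" where
  "V j = (\<Union>k. cyl (hole (prod_encode (j, k))))"

lemma W_eq: "W Q e = {X. \<exists>N. W_str Q e (seg X N)}"
proof (intro set_eqI iffI)
  fix X assume "X \<in> W Q e"
  then consider s where "hit e s (seg X s)" "\<forall>n<s. X \<notin> cyl (hole n)"
    | n s where "X \<in> cyl (hole n)" "hit (e + n + 3) s (seg X s)"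
    | n where "Q e n" "X \<in> cyl (hole n)"
    unfolding W_def hits_def by blast
  then show "X \<in> {X. \<exists>N. W_str Q e (seg X N)}"
  proof cases
    case 1
    \<comment> \<open>A prefix of length \<open>s + 3\<close> shows stage \<open>s\<close> and all
      the holes below \<open>s\<close>; in the second case \<open>s + n + 3\<close> covers the stage
      and hole \<open>n\<close>.\<close>
    then have "W_str Q e (seg X (s + 3))"
      unfolding W_str_def
      by (intro disjI1 exI[of _ s]) (auto simp: hit_seg[of s "s + 3"] take_seg mem_cyl_iff)
    then show ?thesis by blast
  next
    case 2
    then have "W_str Q e (seg X (s + n + 3))"
      unfolding W_str_def
      by - (rule disjI2, rule disjI1, rule exI[of _ n], auto simp: hit_seg[of s "s + n + 3"] take_seg mem_cyl_iff intro: exI[of _ s])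
    then show ?thesis by blast
  next
    case 3
    then have "W_str Q e (seg X (n + 3))"
      unfolding W_str_def by (intro disjI2 exI[of _ n]) (auto simp: mem_cyl_iff)
    then show ?thesis by blast
  qed
next
  fix X assume "X \<in> {X. \<exists>N. W_str Q e (seg X N)}"
  then obtain N where "W_str Q e (seg X N)" by blast
  then consider s where "s \<le> N" "hit e s (seg X N)" "\<forall>n<s. n + 3 \<le> N \<and> take (n + 3) (seg X N) \<noteq> hole n"
    | n s where "n + 3 \<le> N" "take (n + 3) (seg X N) = hole n" "s \<le> N" "hit (e + n + 3) s (seg X N)"
    | n where "Q e n" "seg X N = hole n"
    unfolding W_str_def length_seg by blast
  then show "X \<in> W Q e"
  proof cases
    case 1
    then have "hit e s (seg X s)" "\<forall>n<s. X \<notin> cyl (hole n)"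
      by (auto simp: hit_seg[of s N] take_seg mem_cyl_iff)
    then show ?thesis unfolding W_def by blast
  next
    case 2
    then have "X \<in> cyl (hole n)" "hit (e + n + 3) s (seg X s)"
      by (auto simp: hit_seg[of s N] take_seg mem_cyl_iff)
    then show ?thesis unfolding W_def hits_def by blast
  next
    case 3
    then have "X \<in> cyl (hole n)" using mem_cyl_seg[of X N] by simp
    with 3 show ?thesis unfolding W_def by blast
  qed
qed

section \<open>Both sequences are tests\<close>

lemma unif_eff_open_W:
  assumes "semidec (\<lambda>p. Q (fst p) (snd p))"
  shows "unif_eff_open (W Q)"
proof (rule unif_eff_openI[OF _ W_eq])
  show "semidec (\<lambda>p. W_str Q (fst p) (snd p))"
    unfolding W_str_def
    by (intro semidec_disj semidec_Ex semidec_conj semidec_comp2[OF assms] comp_intros;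
        (intro semidec_computable comp_intros)?)
qed

lemma unif_eff_open_V: "unif_eff_open V"
proof (rule unif_eff_openI)
  show "semidec (\<lambda>p. \<exists>k. snd p = hole (prod_encode (fst p, k)))"
    by (intro semidec_Ex semidec_computable comp_intros)
  show "V j = {X. \<exists>n. \<exists>k. seg X n = hole (prod_encode (j, k))}" for j
  proof -
    have "X \<in> cyl \<sigma> \<longleftrightarrow> (\<exists>n. seg X n = \<sigma>)" for X \<sigma>
      by (metis length_seg mem_cyl_iff)
    then show ?thesis unfolding V_def by blast
  qed
qed

text \<open>Gives the holes making up \<open>V j\<close> measure at most
  \<open>(1/2) ^ (j + k + 3)\<close>, with sum at most \<open>(1/2) ^ j / 4\<close>.\<close>

lemma add_le_prod_encode: "j + k \<le> prod_encode (j, k)"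
proof -
  have "n \<le> triangle n" for n by (induction n) auto
  from this[of "j + k"] show ?thesis by (simp add: prod_encode_def)
qed

lemma mltest_V: "mltest V"
  unfolding mltest_def
proof (intro conjI allI unif_eff_open_V)
  fix j
  have "measure lambda_measure (V j) \<le> 2 * ((1/2) ^ j / 8)"
    unfolding V_def
  proof (rule measure_UN_le)
    fix k
    have "(1/2) ^ (prod_encode (j, k) + 3) \<le> ((1/2) ^ (j + k + 3) :: real)"
      using add_le_prod_encode by (intro power_decreasing) auto
    then show "measure lambda_measure (cyl (hole (prod_encode (j, k)))) \<le> (1/2) ^ j / 8 * (1/2) ^ k"
      by (simp add: measure_cyl power_add power3_eq_cube power4_eq_xxxx)
  qed (rule cyl_sets)
  also have "\<dots> \<le> (1/2) ^ j" by simp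
  finally show "measure lambda_measure (V j) \<le> (1/2) ^ j" .
qed

text \<open>By \<open>e \<le> n\<close> only holes numbered from \<open>e\<close> on enter
  \<open>W Q e\<close> as a whole. The three parts contribute at most 1/8, 1/32 and 1/4 of
  \<open>(1/2) ^ e\<close>.\<close>

lemma mltest_W:
  assumes Q: "semidec (\<lambda>p. Q (fst p) (snd p))" and le: "\<And>e n. Q e n \<Longrightarrow> e \<le> n"
  shows "mltest (W Q)"
  unfolding mltest_def
proof (intro conjI allI unif_eff_open_W[OF Q])
  fix e
  let ?A = "hits e" and ?B = "\<Union>n. hits (e + n + 3)" and ?C = "\<Union>k. cyl (hole (e + k))"
  have B: "?B \<in> sets lambda_measure" by (intro sets.countable_UN) (auto simp: sets_hits)
  have C: "?C \<in> sets lambda_measure" by (intro sets.countable_UN) (auto simp: cyl_sets)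
  have mB: "measure lambda_measure ?B \<le> 2 * ((1/2) ^ e / 64)"
  proof (rule measure_UN_le)
    show "measure lambda_measure (hits (e + n + 3)) \<le> (1/2) ^ e / 64 * (1/2) ^ n" for n
      using measure_hits_le[of "e + n + 3"] by (simp add: power_add power3_eq_cube power4_eq_xxxx)
  qed (rule sets_hits)
  have mC: "measure lambda_measure ?C \<le> 2 * ((1/2) ^ e / 8)"
    by (rule measure_UN_le) (auto simp: cyl_sets measure_cyl power_add power3_eq_cube power4_eq_xxxx)
  have "W Q e \<subseteq> (?A \<union> ?B) \<union> ?C"
  proof
    fix X assume "X \<in> W Q e"
    then consider "X \<in> ?A" | "X \<in> ?B" | n where "Q e n" "X \<in> cyl (hole n)"
      unfolding W_def hits_def by blast
    then show "X \<in> (?A \<union> ?B) \<union> ?C"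
    proof cases
      case 3
      then have "X \<in> cyl (hole (e + (n - e)))" using le by simp
      then show ?thesis by blast
    qed blast+
  qed
  then have "measure lambda_measure (W Q e) \<le> measure lambda_measure ((?A \<union> ?B) \<union> ?C)"
    by (intro lambda.finite_measure_mono sets.Un sets_hits B C)
  also have "\<dots> \<le> measure lambda_measure (?A \<union> ?B) + measure lambda_measure ?C"
    by (intro measure_Un_le sets.Un sets_hits B C)
  also have "\<dots> \<le> measure lambda_measure ?A + measure lambda_measure ?B + measure lambda_measure ?C"
    using measure_Un_le[OF sets_hits B] by simp
  also have "\<dots> \<le> (1/2) ^ e / 8 + 2 * ((1/2) ^ e / 64) + 2 * ((1/2) ^ e / 8)"
    using measure_hits_le[of e] mB mC by linarith
  also have "\<dots> \<le> (1/2) ^ e" by simp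
  finally show "measure lambda_measure (W Q e) \<le> (1/2) ^ e" .
qed

text \<open>Trimming leaves a genuine test unchanged: whatever its machine \<open>m\<close> has
  enumerated at any stage lies inside \<open>T i\<close>, so all stages are admissible. A point of
  \<open>T (e + m + 4)\<close> is then covered from some stage on.\<close>

lemma mltest_Inter_hits:
  assumes T: "mltest T" and X: "X \<in> (\<Inter>i. T i)"
  shows "\<exists>s0. \<forall>s\<ge>s0. hit e s (seg X s)"
proof -
  let ?S = "{prod_encode (i, str_code \<sigma>) |i \<sigma>. cyl \<sigma> \<subseteq> T i}"
  obtain t where t: "?S = {x. \<exists>y. eval (chr {}) t [x] y}"
    using T unfolding mltest_def unif_eff_open_def ce_def by blast
  define m where "m = code t"
  have halts: "(\<exists>s. halts_by m (prod_encode (i, str_code \<sigma>)) s) \<longleftrightarrow> cyl \<sigma> \<subseteq> T i" for i \<sigma>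
  proof -
    have "(\<exists>s. halts_by m (prod_encode (i, str_code \<sigma>)) s) \<longleftrightarrow> prod_encode (i, str_code \<sigma>) \<in> ?S"
      unfolding m_def halts_by_iff t by simp
    also have "\<dots> \<longleftrightarrow> cyl \<sigma> \<subseteq> T i"
      by (auto simp: prod_encode_eq str_code_eq_enc enc_eq_iff)
    finally show ?thesis .
  qed
  have op: "cantor_open (T i)" for i using T unfolding mltest_def unif_eff_open_def by blast
  have adm: "admissible m i s" for i s
  proof -
    have "{Y. covered m i s (seg Y s)} \<subseteq> T i"
    proof
      fix Y assume "Y \<in> {Y. covered m i s (seg Y s)}"
      then obtain k where "halts_by m (prod_encode (i, str_code (seg Y k))) s"
        unfolding covered_seg by blast
      then have "cyl (seg Y k) \<subseteq> T i" using halts by blast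
      then show "Y \<in> T i" using mem_cyl_seg by blast
    qed
    then have "measure lambda_measure {Y. covered m i s (seg Y s)} \<le> measure lambda_measure (T i)"
      by (intro lambda.finite_measure_mono sets_cantor_open op)
    also have "\<dots> \<le> (1/2) ^ i" using T unfolding mltest_def by blast
    finally show ?thesis by (simp add: admissible_iff)
  qed
  let ?i = "e + m + 4"
  obtain \<sigma> where \<sigma>: "X \<in> cyl \<sigma>" "cyl \<sigma> \<subseteq> T ?i"
    using X op[of ?i] unfolding cantor_open_def by blast
  then obtain s1 where s1: "halts_by m (prod_encode (?i, str_code \<sigma>)) s1" using halts by blast
  \<comment> \<open>The stage must exceed \<open>e\<close> and \<open>m\<close> for the bounds in
    \<open>hit\<close>, show all of \<open>\<sigma>\<close>, and come after its enumeration at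
    \<open>s1\<close>.\<close>
  have "hit e s (seg X s)" if s: "Suc (e + m + length \<sigma> + s1) \<le> s" for s
  proof -
    have "seg X (length \<sigma>) = \<sigma>" using \<sigma>(1) by (simp add: mem_cyl_iff)
    then have "covered m ?i s (seg X s)"
      unfolding covered_seg using s halts_by_mono[OF s1, of s]
      by (intro exI[of _ "length \<sigma>"]) auto
    with adm s show ?thesis unfolding hit_def by (intro conjI exI[of _ m]) auto
  qed
  then show ?thesis by blast
qed

section \<open>Universality, and the inclusions between the two tests\<close>

lemma universal_W:
  assumes "semidec (\<lambda>p. Q (fst p) (snd p))" "\<And>e n. Q e n \<Longrightarrow> e \<le> n"
  shows "universal_mltest (W Q)"
  unfolding universal_mltest_def
proof (intro conjI allI impI subsetI INT_I)
  show "mltest (W Q)" using assms by (rule mltest_W)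
  fix T X e assume T: "mltest T" "X \<in> (\<Inter>i. T i)"
  show "X \<in> W Q e"
  proof (cases "\<exists>n. X \<in> cyl (hole n)")
    case True
    then obtain n where "X \<in> cyl (hole n)" by blast
    moreover have "X \<in> hits (e + n + 3)"
      using mltest_Inter_hits[OF T, of "e + n + 3"] unfolding hits_def by blast
    ultimately show ?thesis unfolding W_def by blast
  next
    case False
    moreover obtain s where "hit e s (seg X s)"
      using mltest_Inter_hits[OF T, of e] by blast
    ultimately show ?thesis unfolding W_def by blast
  qed
qed

text \<open>Without \<open>Q e n\<close>, the first part of \<open>W\<close> misses hole
  \<open>n\<close> and the other holes are disjoint from it. What remains is
  \<open>hits (e + n + 3)\<close>, whose measure is at most an eighth of that of the hole.\<close>

lemma cyl_hole_subset_W: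
  assumes "cyl (hole n) \<subseteq> W Q e"
  shows "Q e n"
proof (rule ccontr)
  assume "\<not> Q e n"
  have "cyl (hole n) \<subseteq> hits (e + n + 3)"
  proof
    fix X assume X: "X \<in> cyl (hole n)"
    with assms consider s where "hit e s (seg X s)" "\<forall>k<s. X \<notin> cyl (hole k)"
      | k where "X \<in> cyl (hole k)" "X \<in> hits (e + k + 3)"
      | k where "Q e k" "X \<in> cyl (hole k)"
      unfolding W_def by blast
    then show "X \<in> hits (e + n + 3)"
    proof cases
      case 1
      \<comment> \<open>For \<open>n < s\<close> the exclusion clause of the first part would keep
        \<open>X\<close> out of hole \<open>n\<close>; for \<open>s \<le> n\<close> freshness of the
        hole rules out the hit.\<close>
      have "s \<le> n"
      proof (rule ccontr)
        assume "\<not> s \<le> n"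
        with 1(2) X show False by simp
      qed
      moreover have "seg X (n + 3) = hole n" using X by (simp add: mem_cyl_iff)
      ultimately have "hit e s (hole n)" using 1(1) hit_seg[of s "n + 3" e X] by simp
      with hole_not_hit[OF \<open>s \<le> n\<close>] show ?thesis by blast
    next
      case 2
      from cyl_hole_disjoint[OF this(1) X] 2(2) show ?thesis by simp
    next
      case 3
      from cyl_hole_disjoint[OF this(2) X] 3(1) \<open>\<not> Q e n\<close> show ?thesis by simp
    qed
  qed
  then have "measure lambda_measure (cyl (hole n)) \<le> measure lambda_measure (hits (e + n + 3))"
    by (intro lambda.finite_measure_mono sets_hits)
  also have "\<dots> \<le> (1/2) ^ (e + n + 3) / 8" by (rule measure_hits_le)
  also have "\<dots> \<le> (1/2) ^ (n + 3) / 8"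
    by (intro divide_right_mono power_decreasing) auto
  also have "\<dots> < (1/2) ^ (n + 3)" by simp
  finally show False by (simp add: measure_cyl)
qed

lemma V_subset_W_iff: "V j \<subseteq> W Q e \<longleftrightarrow> (\<forall>k. Q e (prod_encode (j, k)))"
proof
  assume sub: "V j \<subseteq> W Q e"
  show "\<forall>k. Q e (prod_encode (j, k))"
  proof
    fix k
    have "cyl (hole (prod_encode (j, k))) \<subseteq> V j" unfolding V_def by blast
    with sub have "cyl (hole (prod_encode (j, k))) \<subseteq> W Q e" by (rule subset_trans[rotated])
    then show "Q e (prod_encode (j, k))" by (rule cyl_hole_subset_W)
  qed
next
  assume "\<forall>k. Q e (prod_encode (j, k))"
  then show "V j \<subseteq> W Q e" unfolding V_def W_def by blast
qed

section \<open>Coding \<open>0''\<close>\<close>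

text \<open>An index \<open>j = \<langle>e, \<langle>b, d\<rangle>\<rangle>\<close> claims \<open>e \<in> 0''\<close> with witness \<open>d\<close> if \<open>b \<noteq> 0\<close>, and
  \<open>e \<notin> 0''\<close> if \<open>b = 0\<close>. Both claims are \<open>\<Pi>\<^sub>2\<close>, and \<open>claim\<close> is the matrix to be verified at every \<open>k\<close>.\<close>

definition claim ::
  "(nat \<Rightarrow> nat \<Rightarrow> nat \<Rightarrow> bool) \<Rightarrow> (nat \<Rightarrow> nat \<Rightarrow> nat \<Rightarrow> bool) \<Rightarrow> nat \<Rightarrow> nat \<Rightarrow> nat \<Rightarrow> nat \<Rightarrow> bool" where
  "claim RA RB e b d k \<longleftrightarrow>
    b \<noteq> 0 \<and> (\<exists>n. RA e d n) \<and> \<not> RB e d k \<or>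
    b = 0 \<and> (\<not> RA e (fst (prod_decode k)) (snd (prod_decode k)) \<or> (\<exists>n. RB e (fst (prod_decode k)) n))"

text \<open>For \<open>b = 0\<close> the number \<open>k\<close> packs a candidate \<open>d\<close>
  and a witness for \<open>RA\<close>: every candidate confirmed by \<open>RA\<close> has to be
  refuted by \<open>RB\<close>. This is the negation of the Sigma_2 form.\<close>

lemma claim_iff:
  assumes "\<And>e. e \<in> Z \<longleftrightarrow> (\<exists>d. (\<exists>n. RA e d n) \<and> \<not> (\<exists>n. RB e d n))"
  shows "(\<forall>k. claim RA RB e b d k) \<longleftrightarrow>
    (if b \<noteq> 0 then (\<exists>n. RA e d n) \<and> \<not> (\<exists>n. RB e d n) else e \<notin> Z)"
proof (cases "b = 0")
  case True
  have "(\<forall>k. claim RA RB e b d k) \<longleftrightarrow>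
      (\<forall>k. \<not> RA e (fst (prod_decode k)) (snd (prod_decode k)) \<or> (\<exists>n. RB e (fst (prod_decode k)) n))"
    using True by (simp add: claim_def)
  also have "\<dots> \<longleftrightarrow> (\<forall>d n. \<not> RA e d n \<or> (\<exists>n. RB e d n))"
    by (metis fst_conv snd_conv prod_encode_inverse)
  also have "\<dots> \<longleftrightarrow> \<not> (\<exists>d. (\<exists>n. RA e d n) \<and> \<not> (\<exists>n. RB e d n))" by blast
  also have "\<dots> \<longleftrightarrow> e \<notin> Z" by (simp only: assms)
  finally show ?thesis using True by simp
qed (auto simp: claim_def)

theorem theorem3p4:
  shows "\<exists>W V. mltest W \<and> mltest V \<and> universal_mltest W \<and>
           (\<forall>i. \<exists>j. V j \<subseteq> W i) \<and>
           (\<forall>f::nat \<Rightarrow> nat. (\<forall>i. V (f i) \<subseteq> W i) \<longrightarrow> turing_le (chr zero_jump2) f)"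
proof -
  obtain A B :: "nat \<times> nat \<Rightarrow> bool" where A: "semidec A" and B: "semidec B"
    and Z: "\<And>e. e \<in> zero_jump2 \<longleftrightarrow> (\<exists>d. A (e, d) \<and> \<not> B (e, d))"
    by (rule zero_jump2_sigma2) blast
  obtain R where R: "computable (\<lambda>p. R (fst p) (snd p))" "\<And>p. A p \<longleftrightarrow> (\<exists>n::nat. R p n)"
    using A by (rule semidecE) blast
  obtain S where S: "computable (\<lambda>p. S (fst p) (snd p))" "\<And>p. B p \<longleftrightarrow> (\<exists>n::nat. S p n)"
    using B by (rule semidecE) blast
  define RA where "RA e d n = R (e, d) n" for e d n
  define RB where "RB e d n = S (e, d) n" for e d n
  have ZR: "e \<in> zero_jump2 \<longleftrightarrow> (\<exists>d. (\<exists>n. RA e d n) \<and> \<not> (\<exists>n. RB e d n))" for e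
    by (simp only: Z R(2) S(2) RA_def RB_def)
  define tag where "tag j = fst (prod_decode j)" for j
  define bit where "bit j = fst (prod_decode (snd (prod_decode j)))" for j
  define wit where "wit j = snd (prod_decode (snd (prod_decode j)))" for j
  \<comment> \<open>A hole number \<open>n\<close> is read as a pair of an index \<open>j\<close> of
    \<open>V\<close> and an instance \<open>k\<close> of the claim made by \<open>j\<close>. The tag
    admits \<open>V j\<close> only into the component that \<open>j\<close> speaks about.\<close>
  define Q where "Q e n \<longleftrightarrow> e = tag (fst (prod_decode n)) \<and>
    claim RA RB e (bit (fst (prod_decode n))) (wit (fst (prod_decode n))) (snd (prod_decode n))" for e n
  \<comment> \<open>In \<open>claim\<close> negation falls only on the decidable \<open>RA\<close>
    and \<open>RB\<close>; the unbounded quantifiers are all existential.\<close>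
  have semidec_Q: "semidec (\<lambda>p. Q (fst p) (snd p))"
    unfolding Q_def claim_def tag_def bit_def wit_def RA_def RB_def
    by (intro semidec_disj semidec_conj semidec_Ex;
        (intro semidec_computable comp_intros computable_comp2[OF R(1)] computable_comp2[OF S(1)])?)
  \<comment> \<open>The index \<open>e\<close> is obtained from \<open>n\<close> by decoding twice,
    and decoding does not increase numbers. This is the bound that \<open>mltest_W\<close> asks
    for.\<close>
  have Q_le: "e \<le> n" if "Q e n" for e n
  proof -
    have fst_le: "fst (prod_decode m) \<le> m" for m
      using le_prod_encode_1[of "fst (prod_decode m)" "snd (prod_decode m)"] by simp
    have "e = fst (prod_decode (fst (prod_decode n)))"
      using that unfolding Q_def tag_def by (rule conjunct1)
    then show ?thesis using fst_le[of "fst (prod_decode n)"] fst_le[of n] by linarith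
  qed
  have sub: "V j \<subseteq> W Q e \<longleftrightarrow> e = tag j \<and>
      (if bit j \<noteq> 0 then (\<exists>n. RA e (wit j) n) \<and> \<not> (\<exists>n. RB e (wit j) n) else e \<notin> zero_jump2)" for j e
    unfolding V_subset_W_iff claim_iff[OF ZR, symmetric] by (simp add: Q_def)
  have "\<exists>j. V j \<subseteq> W Q e" for e
  proof (cases "e \<in> zero_jump2")
    case True
    then obtain d where "(\<exists>n. RA e d n) \<and> \<not> (\<exists>n. RB e d n)" by (auto simp: ZR)
    then have "V (prod_encode (e, prod_encode (1, d))) \<subseteq> W Q e"
      unfolding sub by (simp add: tag_def bit_def wit_def)
    then show ?thesis ..
  next
    case False
    then have "V (prod_encode (e, prod_encode (0, 0))) \<subseteq> W Q e"
      unfolding sub by (simp add: tag_def bit_def wit_def)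
    then show ?thesis ..
  qed
  moreover have "turing_le (chr zero_jump2) f" if f: "\<forall>i. V (f i) \<subseteq> W Q i" for f
  proof -
    have "computable (\<lambda>j. if bit j \<noteq> 0 then 1 else 0 :: nat)"
      unfolding bit_def by (intro comp_intros)
    then obtain t where t: "\<And>g j. eval g t [j] (if bit j \<noteq> 0 then 1 else 0)"
      unfolding computable_def enc_nat_def by blast
    \<comment> \<open>The inclusion certifies the claim made by \<open>f e\<close>: a nonzero bit
      comes with a genuine witness, a zero bit with \<open>e \<notin> zero_jump2\<close>.\<close>
    have "chr zero_jump2 e = (if bit (f e) \<noteq> 0 then 1 else 0)" for e
    proof -
      have "V (f e) \<subseteq> W Q e" using f by blast
      then show ?thesis unfolding sub chr_def ZR by (auto split: if_splits)
    qed
    \<comment> \<open>One query is enough: \<open>f e\<close> itself carries the answer, and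
      \<open>t\<close> extracts it under any oracle, in particular under \<open>f\<close>.\<close>
    moreover have "eval f (Comp t [Oracle]) [e] (if bit (f e) \<noteq> 0 then 1 else 0)" for e
      by (rule eval_Comp1[OF ev_oracle t])
    ultimately have "\<forall>e. eval f (Comp t [Oracle]) [e] (chr zero_jump2 e)" by simp
    then show ?thesis unfolding turing_le_def by (rule exI)
  qed
  moreover have "mltest (W Q)" using semidec_Q Q_le by (rule mltest_W)
  moreover have "universal_mltest (W Q)" using semidec_Q Q_le by (rule universal_W)
  ultimately show ?thesis
    using mltest_V by blast
qed

end
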